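(* Let $G$ be an acyclic ADT network and let $\mathcal C=\{(S,T_1,\mathcal X(S)),\dots,(S,T_N,\mathcal X(S))\}$ be a single multicast connection. Then $(G,\mathcal C)$ is solvable if and only if $\mathrm{mincut}(S,T_i)\ge|\mathcal X(S)|$ for all $i=1,\dots,N$.
   Context: ADT network model. $G=(\mathcal V,\mathcal E)$ is a directed acyclic network of supernodes, each with input ports $I(V)$ and output ports $O(V)$. Edges go from output ports to input ports of other supernodes. Linear coding over a finite field $\mathbb F_q$: - An output port $e\in O(V)$ carries $Y(e)=\sum_{e'\in I(V)}\beta_{(e',e)}Y(e')$. At the source $S$, the term $\sum_i\alpha_{(i,e)}X(S,i)$ is added, where $\mathcal X(S)=[X(S,1),\dots,X(S,\mu(S))]$ are the independent source processes. - An output port sends the same symbol on all of its outgoing edges (broadcast). - An input port $e'$ receives $Y(e')=\sum_{(e,e')\in\mathcal E}Y(e)$, the sum taken over $\mathbb F_q$. - A destination $T$ outputs $Z(T,k)=\sum_{e'\in I(T)}\epsilon_{(e',(T,k))}Y(e')$. $(G,\mathcal C)$ is solvable if some single choice of coefficients $\alpha,\beta,\epsilon$ makes every destination $T_i$ output exactly $\mathcal X(S)$. Following the paper's convention, the field size $q$ may be chosen as large as needed, so solvable means solvable by linear coding over some sufficiently large $\mathbb F_q$. $\mathrm{mincut}(S,T)=\min_\Omega\mathrm{rank}(G_\Omega)$, with the minimum over partitions $\Omega\cup\Omega^c$ of the supernodes with $S\in\Omega$ and $T\in\Omega^c$. $G_\Omega$ is the $0$-$1$ incidence matrix of the edges from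 output ports of supernodes in $\Omega$ to input ports of supernodes in $\Omega^c$. *)

theory Defs
  imports "HOL-Algebra.Algebra" "HOL-Number_Theory.Residues"
begin

definition node_rel :: "'v set \<Rightarrow> ('v \<Rightarrow> 'p set) \<Rightarrow> ('v \<Rightarrow> 'p set) \<Rightarrow> ('p \<times> 'p) set \<Rightarrow> ('v \<times> 'v) set" where
  "node_rel V In Out E =
     {(v, w). v \<in> V \<and> w \<in> V \<and> (\<exists>e \<in> Out v. \<exists>e' \<in> In w. (e, e') \<in> E)}"

definition adt_network :: "'v set \<Rightarrow> ('v \<Rightarrow> 'p set) \<Rightarrow> ('v \<Rightarrow> 'p set) \<Rightarrow> ('p \<times> 'p) set \<Rightarrow> bool" where
  "adt_network V In Out E \<longleftrightarrow>
     finite V \<and>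
     (\<forall>v \<in> V. finite (In v) \<and> finite (Out v) \<and> In v \<inter> Out v = {}) \<and>
     (\<forall>v \<in> V. \<forall>w \<in> V. v \<noteq> w \<longrightarrow> (In v \<union> Out v) \<inter> (In w \<union> Out w) = {}) \<and>
     E \<subseteq> {(e, e'). \<exists>v \<in> V. \<exists>w \<in> V. v \<noteq> w \<and> e \<in> Out v \<and> e' \<in> In w} \<and>
     acyclic (node_rel V In Out E)"

definition ports :: "'v set \<Rightarrow> ('v \<Rightarrow> 'p set) \<Rightarrow> ('v \<Rightarrow> 'p set) \<Rightarrow> 'p set" where
  "ports V In Out = (\<Union>v \<in> V. In v \<union> Out v)"

definition coding_equations ::
  "('a, 'b) ring_scheme \<Rightarrow> 'v set \<Rightarrow> ('v \<Rightarrow> 'p set) \<Rightarrow> ('v \<Rightarrow> 'p set) \<Rightarrow> ('p \<times> 'p) set \<Rightarrow>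
   'v \<Rightarrow> nat \<Rightarrow> (nat \<Rightarrow> 'p \<Rightarrow> 'a) \<Rightarrow> ('p \<Rightarrow> 'p \<Rightarrow> 'a) \<Rightarrow> (nat \<Rightarrow> 'a) \<Rightarrow> ('p \<Rightarrow> 'a) \<Rightarrow> bool" where
  "coding_equations R V In Out E S mu \<alpha> \<beta> x Y \<longleftrightarrow>
     (\<forall>e \<in> ports V In Out. Y e \<in> carrier R) \<and>
     (\<forall>v \<in> V. \<forall>e \<in> Out v.
        Y e = finsum R (\<lambda>e'. \<beta> e' e \<otimes>\<^bsub>R\<^esub> Y e') (In v) \<oplus>\<^bsub>R\<^esub>
              (if v = S then finsum R (\<lambda>i. \<alpha> i e \<otimes>\<^bsub>R\<^esub> x i) {1..mu} else \<zero>\<^bsub>R\<^esub>)) \<and>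
     (\<forall>v \<in> V. \<forall>e' \<in> In v. Y e' = finsum R Y {e. (e, e') \<in> E})"

text \<open>Solvability of the multicast connection (S, T i, X(S)), i = 1..N, with
mu = |X(S)| source processes, over the field R: one single choice of coefficients
alpha, beta, epsilon makes every destination T i output exactly the source symbols.\<close>

definition linearly_solvable ::
  "('a, 'b) ring_scheme \<Rightarrow> 'v set \<Rightarrow> ('v \<Rightarrow> 'p set) \<Rightarrow> ('v \<Rightarrow> 'p set) \<Rightarrow> ('p \<times> 'p) set \<Rightarrow>
   'v \<Rightarrow> nat \<Rightarrow> (nat \<Rightarrow> 'v) \<Rightarrow> nat \<Rightarrow> bool" where
  "linearly_solvable R V In Out E S mu T N \<longleftrightarrow>
     (\<exists>\<alpha> \<beta> \<epsilon>.
        (\<forall>i e. \<alpha> i e \<in> carrier R) \<and> (\<forall>e' e. \<beta> e' e \<in> carrier R) \<and>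
        (\<forall>t e' k. \<epsilon> t e' k \<in> carrier R) \<and>
        (\<forall>x \<in> {1..mu} \<rightarrow> carrier R. \<forall>Y.
           coding_equations R V In Out E S mu \<alpha> \<beta> x Y \<longrightarrow>
           (\<forall>n \<in> {1..N}. \<forall>k \<in> {1..mu}.
              finsum R (\<lambda>e'. \<epsilon> (T n) e' k \<otimes>\<^bsub>R\<^esub> Y e') (In (T n)) = x k)))"

definition ring_char :: "('a, 'b) ring_scheme \<Rightarrow> nat" where
  "ring_char R = (LEAST n. 0 < n \<and> add_pow R n \<one>\<^bsub>R\<^esub> = \<zero>\<^bsub>R\<^esub>)"

definition lin_indep_rows :: "('a, 'b) ring_scheme \<Rightarrow> 'c set \<Rightarrow> ('r \<Rightarrow> 'c \<Rightarrow> 'a) \<Rightarrow> 'r set \<Rightarrow> bool" where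
  "lin_indep_rows K Cols M A \<longleftrightarrow>
     (\<forall>c \<in> A \<rightarrow> carrier K.
        (\<forall>j \<in> Cols. finsum K (\<lambda>r. c r \<otimes>\<^bsub>K\<^esub> M r j) A = \<zero>\<^bsub>K\<^esub>) \<longrightarrow> (\<forall>r \<in> A. c r = \<zero>\<^bsub>K\<^esub>))"

definition mat_rank :: "('a, 'b) ring_scheme \<Rightarrow> 'r set \<Rightarrow> 'c set \<Rightarrow> ('r \<Rightarrow> 'c \<Rightarrow> 'a) \<Rightarrow> nat" where
  "mat_rank K Rows Cols M = Max {card A | A. A \<subseteq> Rows \<and> lin_indep_rows K Cols M A}"

definition cut_matrix :: "('a, 'b) ring_scheme \<Rightarrow> ('p \<times> 'p) set \<Rightarrow> 'p \<Rightarrow> 'p \<Rightarrow> 'a" where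
  "cut_matrix K E e e' = (if (e, e') \<in> E then \<one>\<^bsub>K\<^esub> else \<zero>\<^bsub>K\<^esub>)"

definition mincut ::
  "('a, 'b) ring_scheme \<Rightarrow> 'v set \<Rightarrow> ('v \<Rightarrow> 'p set) \<Rightarrow> ('v \<Rightarrow> 'p set) \<Rightarrow> ('p \<times> 'p) set \<Rightarrow>
   'v \<Rightarrow> 'v \<Rightarrow> nat" where
  "mincut K V In Out E S T =
     Min {mat_rank K (\<Union>v \<in> \<Omega>. Out v) (\<Union>w \<in> V - \<Omega>. In w) (cut_matrix K E)
          | \<Omega>. \<Omega> \<subseteq> V \<and> S \<in> \<Omega> \<and> T \<notin> \<Omega>}"

end

theory Submission
  imports Defs
begin

text \<open>If \<open>(G, C)\<close> is solvable, the symbols crossing a cut determine everything a sink outputs and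
  lie in the row space of the cut matrix, so the rank of every cut is at least \<open>mu\<close>.

  Conversely, write all coding equations as the columns of one matrix whose rows are the source
  processes and the ports other than the input ports of a sink \<open>t\<close>. The coding coefficients are free
  entries of this matrix, and \<open>t\<close> can decode as soon as the rows are independent. If no choice of the
  free entries makes them independent, the Hartfiel--Loewy theorem yields rows \<open>I\<close> and columns \<open>J\<close>
  such that \<open>I \<times> J\<close> meets no free entry and the submatrix has small rank; the nodes none of whose
  output equations lie in \<open>J\<close> then form a cut of rank less than \<open>mu\<close>. As changing a single
  coefficient spoils decodability at a sink for at most one value, a field with more than \<open>N\<close> elements
  admits coefficients that serve all sinks. Ranks are handled by counting left kernels over the finite
  field, and the rank of a 0-1 matrix depends only on the characteristic.\<close>

section \<open>Left kernels over a finite field\<close>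

text \<open>The obstacle is that the coding matrix mixes free entries with fixed ones: input ports
  add up incoming symbols with coefficients that cannot be chosen. Zero patterns alone therefore do
  not decide whether the rows can be made independent, and the criterion has to speak of ranks of
  fixed blocks. A block on rows \<open>I\<close> and columns \<open>J\<close> has a left kernel of
  size \<open>q ^ (card I - rank)\<close>. An obstruction is a block without free entries whose left
  kernel has dimension larger than the number of remaining columns: however these are filled, some
  nonzero vector of that kernel is annihilated by them as well. In this form submodularity of rank
  becomes an inequality between products of cardinalities, proved by an injection. The obstruction
  exists over every finite field; the size of the field matters only when one filling has to serve
  several sinks.\<close>

definition (in ring) lincomb :: "'r set \<Rightarrow> ('r \<Rightarrow> 'a) \<Rightarrow> ('r \<Rightarrow> 'c \<Rightarrow> 'a) \<Rightarrow> 'c \<Rightarrow> 'a" where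
  "lincomb A a M j = (\<Oplus>r\<in>A. a r \<otimes> M r j)"

text \<open>Vanishing outside \<open>I\<close> makes each vector one total function, so kernels over
  different row sets lie in one type, can be added and compared, and are finite for finite
  \<open>I\<close> over a finite field.\<close>

definition (in ring) vecs :: "'r set \<Rightarrow> ('r \<Rightarrow> 'a) set" where
  "vecs I = {a. (\<forall>i\<in>I. a i \<in> carrier R) \<and> (\<forall>i. i \<notin> I \<longrightarrow> a i = \<zero>)}"

definition (in ring) left_kernel :: "'r set \<Rightarrow> 'c set \<Rightarrow> ('r \<Rightarrow> 'c \<Rightarrow> 'a) \<Rightarrow> ('r \<Rightarrow> 'a) set" where
  "left_kernel I J M = {a \<in> vecs I. \<forall>j\<in>J. lincomb I a M j = \<zero>}"

definition (in ring) is_mat :: "('r \<Rightarrow> 'c \<Rightarrow> 'a) \<Rightarrow> bool" where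
  "is_mat M \<longleftrightarrow> (\<forall>r j. M r j \<in> carrier R)"

context ring
begin

lemma is_matD [simp]: "is_mat M \<Longrightarrow> M r j \<in> carrier R"
  by (simp add: is_mat_def)

lemma vecs_closed: "a \<in> vecs I \<Longrightarrow> a i \<in> carrier R"
  by (cases "i \<in> I") (auto simp: vecs_def)

lemma vecs_mono: "a \<in> vecs I \<Longrightarrow> I \<subseteq> I' \<Longrightarrow> a \<in> vecs I'"
  using vecs_closed by (fastforce simp: vecs_def)

lemma vecs_lin:
  assumes "a \<in> vecs I" "b \<in> vecs I" "s \<in> carrier R" "t \<in> carrier R"
  shows "(\<lambda>i. s \<otimes> a i \<oplus> t \<otimes> b i) \<in> vecs I"
  using assms vecs_closed[OF assms(1)] vecs_closed[OF assms(2)] by (auto simp: vecs_def)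

lemma lincomb_closed:
  assumes "\<And>i. i \<in> A \<Longrightarrow> a i \<in> carrier R" "is_mat M"
  shows "lincomb A a M j \<in> carrier R"
  unfolding lincomb_def by (rule finsum_closed) (use assms in auto)

lemma lincomb_lin:
  assumes "\<And>i. i \<in> A \<Longrightarrow> a i \<in> carrier R" "\<And>i. i \<in> A \<Longrightarrow> b i \<in> carrier R"
    "is_mat M" "s \<in> carrier R" "t \<in> carrier R"
  shows "lincomb A (\<lambda>i. s \<otimes> a i \<oplus> t \<otimes> b i) M j = s \<otimes> lincomb A a M j \<oplus> t \<otimes> lincomb A b M j"
proof (cases "finite A")
  case True
  have "lincomb A (\<lambda>i. s \<otimes> a i \<oplus> t \<otimes> b i) M j
      = (\<Oplus>r\<in>A. s \<otimes> (a r \<otimes> M r j) \<oplus> t \<otimes> (b r \<otimes> M r j))"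
    unfolding lincomb_def by (rule finsum_cong') (use assms in \<open>auto simp: l_distr m_assoc\<close>)
  also have "\<dots> = (\<Oplus>r\<in>A. s \<otimes> (a r \<otimes> M r j)) \<oplus> (\<Oplus>r\<in>A. t \<otimes> (b r \<otimes> M r j))"
    by (rule finsum_addf) (use assms in auto)
  also have "\<dots> = s \<otimes> lincomb A a M j \<oplus> t \<otimes> lincomb A b M j"
    unfolding lincomb_def
    by (subst (1 2) finsum_rdistr[OF True]) (use assms in auto)
  finally show ?thesis .
qed (use assms in \<open>simp add: lincomb_def finsum_infinite\<close>)

lemma lincomb_cong:
  assumes "\<And>i. i \<in> A \<Longrightarrow> a i = b i" "\<And>i. i \<in> A \<Longrightarrow> M i j = M' i j"
    "\<And>i. i \<in> A \<Longrightarrow> b i \<in> carrier R" "\<And>i. i \<in> A \<Longrightarrow> M' i j \<in> carrier R"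
  shows "lincomb A a M j = lincomb A b M' j"
  unfolding lincomb_def by (rule finsum_cong') (use assms in auto)

lemma lincomb_neutral:
  assumes "finite I'" "I \<subseteq> I'" "\<And>i. a i \<in> carrier R" "\<And>i. i \<in> I' - I \<Longrightarrow> a i = \<zero>"
    "is_mat M"
  shows "lincomb I' a M j = lincomb I a M j"
  unfolding lincomb_def
  by (rule add.finprod_mono_neutral_cong_right) (use assms in auto)

lemma lincomb_insert:
  assumes "finite A" "r \<notin> A" "\<And>i. i \<in> insert r A \<Longrightarrow> a i \<in> carrier R" "is_mat M"
  shows "lincomb (insert r A) a M j = a r \<otimes> M r j \<oplus> lincomb A a M j"
  unfolding lincomb_def by (rule finsum_insert) (use assms in auto)

lemma left_kernel_lin:
  assumes "a \<in> left_kernel I J M" "b \<in> left_kernel I J M" "s \<in> carrier R" "t \<in> carrier R"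
    "is_mat M"
  shows "(\<lambda>i. s \<otimes> a i \<oplus> t \<otimes> b i) \<in> left_kernel I J M"
  using assms vecs_lin[of a I b s t]
  by (auto simp: left_kernel_def lincomb_lin vecs_closed)

lemma left_kernel_mono:
  assumes "a \<in> left_kernel I J M" "finite I'" "I \<subseteq> I'" "J' \<subseteq> J" "is_mat M"
  shows "a \<in> left_kernel I' J' M"
proof -
  have a: "a \<in> vecs I" using assms by (simp add: left_kernel_def)
  have "lincomb I' a M j = lincomb I a M j" for j
    by (rule lincomb_neutral) (use assms a vecs_closed[OF a] in \<open>auto simp: vecs_def\<close>)
  thus ?thesis using assms vecs_mono[OF a] by (auto simp: left_kernel_def)
qed

lemma left_kernel_closed: "a \<in> left_kernel I J M \<Longrightarrow> a i \<in> carrier R"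
  by (auto simp: left_kernel_def intro: vecs_closed)

lemma zero_in_left_kernel:
  assumes "is_mat M"
  shows "(\<lambda>_. \<zero>) \<in> left_kernel I J M"
  unfolding left_kernel_def vecs_def lincomb_def
  by (auto intro!: add.finprod_one_eqI simp: assms)

text \<open>Coefficients in \<open>lin_indep_rows\<close> are arbitrary outside \<open>A\<close>;
  setting them to zero there identifies independence with triviality of the left kernel, the form
  used throughout.\<close>

lemma lin_indep_rows_iff:
  assumes "is_mat M"
  shows "lin_indep_rows R J M A \<longleftrightarrow> (\<forall>a\<in>left_kernel A J M. \<forall>i. a i = \<zero>)"
proof
  assume L: "lin_indep_rows R J M A"
  show "\<forall>a\<in>left_kernel A J M. \<forall>i. a i = \<zero>"
  proof (intro ballI allI)
    fix a i assume "a \<in> left_kernel A J M"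
    thus "a i = \<zero>"
      using L by (cases "i \<in> A") (auto simp: lin_indep_rows_def left_kernel_def vecs_def lincomb_def)
  qed
next
  assume L: "\<forall>a\<in>left_kernel A J M. \<forall>i. a i = \<zero>"
  show "lin_indep_rows R J M A"
    unfolding lin_indep_rows_def
  proof (intro ballI impI)
    fix c r assume c: "c \<in> A \<rightarrow> carrier R"
      and z: "\<forall>j\<in>J. (\<Oplus>r\<in>A. c r \<otimes> M r j) = \<zero>" and r: "r \<in> A"
    define a where "a = (\<lambda>i. if i \<in> A then c i else \<zero>)"
    have a: "a \<in> vecs A" using c by (auto simp: a_def vecs_def)
    have "lincomb A a M j = lincomb A c M j" for j
      by (rule lincomb_cong) (use c assms in \<open>auto simp: a_def\<close>)
    hence "a \<in> left_kernel A J M" using a z by (auto simp: left_kernel_def lincomb_def)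
    hence "a r = \<zero>" using L by blast
    thus "c r = \<zero>" using r by (simp add: a_def)
  qed
qed

lemma lin_indep_rowsD:
  assumes "lin_indep_rows R J M I" "a \<in> left_kernel I J M" "is_mat M"
  shows "a i = \<zero>"
  using assms lin_indep_rows_iff by blast

text \<open>Associativity \<open>(a M) L = a (M L)\<close>, by exchanging two finite sums. It allows
  an equation \<open>a M = 0\<close> to be multiplied by a right inverse.\<close>

lemma lincomb_lincomb:
  assumes "finite A" "finite B" "\<And>i. i \<in> A \<Longrightarrow> a i \<in> carrier R" "is_mat M"
    "is_mat L"
  shows "lincomb B (lincomb A a M) L k = lincomb A a (\<lambda>i. lincomb B (M i) L) k"
proof -
  have "lincomb B (lincomb A a M) L k = (\<Oplus>j\<in>B. \<Oplus>i\<in>A. a i \<otimes> M i j \<otimes> L j k)"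
    unfolding lincomb_def
    by (rule finsum_cong') (use assms in \<open>auto intro!: finsum_closed finsum_ldistr\<close>)
  also have "\<dots> = (\<Oplus>i\<in>A. \<Oplus>j\<in>B. a i \<otimes> M i j \<otimes> L j k)"
    using assms(1,2,3)
  proof (induction A rule: finite_induct)
    case empty
    thus ?case by (simp add: finsum_zero)
  next
    case (insert x A)
    have "(\<Oplus>j\<in>B. \<Oplus>i\<in>insert x A. a i \<otimes> M i j \<otimes> L j k)
        = (\<Oplus>j\<in>B. a x \<otimes> M x j \<otimes> L j k \<oplus> (\<Oplus>i\<in>A. a i \<otimes> M i j \<otimes> L j k))"
      by (rule finsum_cong', rule refl)
        (use insert assms in \<open>auto intro!: finsum_closed finsum_insert\<close>)
    also have "\<dots> = (\<Oplus>j\<in>B. a x \<otimes> M x j \<otimes> L j k) \<oplus> (\<Oplus>j\<in>B. \<Oplus>i\<in>A. a i \<otimes> M i j \<otimes> L j k)"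
      by (rule finsum_addf) (use insert assms in \<open>auto intro!: finsum_closed\<close>)
    also have "\<dots> = (\<Oplus>i\<in>insert x A. \<Oplus>j\<in>B. a i \<otimes> M i j \<otimes> L j k)"
      by (subst finsum_insert) (use insert assms in \<open>auto intro!: finsum_closed\<close>)
    finally show ?case .
  qed
  also have "\<dots> = lincomb A a (\<lambda>i. lincomb B (M i) L) k"
    unfolding lincomb_def
    by (rule finsum_cong')
      (use assms in \<open>auto intro!: finsum_closed simp: finsum_rdistr m_assoc\<close>)
  finally show ?thesis .
qed

end

section \<open>Counting left kernels over a field with \<open>q\<close> elements\<close>

locale finite_field = field +
  assumes finite_carrier: "finite (carrier R)"
begin

definition q :: nat where "q = card (carrier R)"

lemma q_gt_1: "q > 1"
proof -
  have "card {\<zero>, \<one>} \<le> q" unfolding q_def by (rule card_mono) (use finite_carrier in auto)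
  thus ?thesis by simp
qed

lemma finite_vecs:
  assumes "finite I"
  shows "finite (vecs I)"
proof (rule inj_on_finite)
  show "inj_on (\<lambda>a. restrict a I) (vecs I)"
    by (rule inj_onI, rule ext) (auto simp: vecs_def fun_eq_iff restrict_def, metis)
  show "(\<lambda>a. restrict a I) ` vecs I \<subseteq> PiE I (\<lambda>_. carrier R)"
    by (auto simp: vecs_def)
  show "finite (PiE I (\<lambda>_. carrier R))"
    using assms finite_carrier by (simp add: finite_PiE)
qed

lemma finite_left_kernel: "finite I \<Longrightarrow> finite (left_kernel I J M)"
  using finite_vecs[of I] by (simp add: left_kernel_def)

text \<open>The fibres of \<open>(a, b) \<mapsto> a + b\<close> on the product of two left kernels are
  translates of the left kernel for the intersected rows and united columns.\<close>

lemma card_left_kernel_uncross: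
  fixes M :: "'r \<Rightarrow> 'c \<Rightarrow> 'a"
  assumes "finite I1" "finite I2" and M: "is_mat M"
  shows "card (left_kernel I1 J1 M) * card (left_kernel I2 J2 M)
    \<le> card (left_kernel (I1 \<union> I2) (J1 \<inter> J2) M) * card (left_kernel (I1 \<inter> I2) (J1 \<union> J2) M)"
proof -
  let ?N1 = "left_kernel I1 J1 M" and ?N2 = "left_kernel I2 J2 M"
  let ?U = "left_kernel (I1 \<union> I2) (J1 \<inter> J2) M" and ?D = "left_kernel (I1 \<inter> I2) (J1 \<union> J2) M"
  define pl where "pl = (\<lambda>(a, b) (i::'r). a i \<oplus> b i)"
  \<comment> \<open>\<open>g\<close> picks one pair in each fibre of the sum, and \<open>h\<close>
    records a pair by its sum and its displacement from the chosen pair. The first component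
    suffices for the displacement, since the sum then forces the second.\<close>
  define g where "g s = (SOME x. x \<in> ?N1 \<times> ?N2 \<and> pl x = s)" for s
  have g: "g (pl x) \<in> ?N1 \<times> ?N2 \<and> pl (g (pl x)) = pl x" if "x \<in> ?N1 \<times> ?N2" for x
    unfolding g_def by (rule someI_ex) (use that in blast)
  define h where "h x = (pl x, \<lambda>i. fst x i \<ominus> fst (g (pl x)) i)" for x
  have cl: "a i \<in> carrier R" if "a \<in> left_kernel I J M" for a i and I :: "'r set" and J :: "'c set"
    using that by (rule left_kernel_closed)
  have plU: "pl x \<in> ?U" if "x \<in> ?N1 \<times> ?N2" for x
  proof -
    obtain a b where x: "x = (a, b)" "a \<in> ?N1" "b \<in> ?N2" using \<open>x \<in> _\<close> by auto
    have "(\<lambda>i. \<one> \<otimes> a i \<oplus> \<one> \<otimes> b i) \<in> ?U"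
      by (rule left_kernel_lin) (use x assms in \<open>auto elim!: left_kernel_mono\<close>)
    thus ?thesis using x cl by (simp add: pl_def)
  qed
  have hD: "(\<lambda>i. a i \<ominus> a' i) \<in> ?D"
    if "a \<in> ?N1" "b \<in> ?N2" "a' \<in> ?N1" "b' \<in> ?N2" and eq: "pl (a, b) = pl (a', b')" for a b a' b'
  proof -
    have eq': "a i \<oplus> b i = a' i \<oplus> b' i" for i
      using fun_cong[OF eq, of i] by (simp add: pl_def)
    \<comment> \<open>Equal sums tie the displacement of the first components to that of the second,
      so it lies in both kernels: it is supported on \<open>I1 \<inter> I2\<close> and annihilated
      by all columns in \<open>J1 \<union> J2\<close>.\<close>
    have d: "a i \<ominus> a' i = b' i \<ominus> b i" for i
      using eq'[of i] cl[OF that(1), of i] cl[OF that(2), of i] cl[OF that(3), of i] cl[OF that(4), of i]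
      by (metis a_minus_def add.inv_closed add.inv_solve_right add.m_assoc add.m_comm add.m_closed)
    have mm: "\<ominus> \<one> \<otimes> x = \<ominus> x" if "x \<in> carrier R" for x using that by (simp add: l_minus)
    have "(\<lambda>i. \<one> \<otimes> a i \<oplus> (\<ominus> \<one>) \<otimes> a' i) \<in> ?N1" "(\<lambda>i. \<one> \<otimes> b' i \<oplus> (\<ominus> \<one>) \<otimes> b i) \<in> ?N2"
      by (rule left_kernel_lin; use that assms in auto)+
    hence 1: "(\<lambda>i. a i \<ominus> a' i) \<in> ?N1" and 2: "(\<lambda>i. a i \<ominus> a' i) \<in> ?N2"
      unfolding d using that cl by (simp_all add: mm a_minus_def d[symmetric, unfolded a_minus_def])
    let ?d = "\<lambda>i. a i \<ominus> a' i"
    have v: "?d \<in> vecs (I1 \<inter> I2)" using 1 2 by (auto simp: left_kernel_def vecs_def)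
    have "lincomb I1 ?d M j = lincomb (I1 \<inter> I2) ?d M j" for j
      by (rule lincomb_neutral) (use assms vecs_closed[OF v] v in \<open>auto simp: vecs_def\<close>)
    moreover have "lincomb I2 ?d M j = lincomb (I1 \<inter> I2) ?d M j" for j
      by (rule lincomb_neutral) (use assms vecs_closed[OF v] v in \<open>auto simp: vecs_def\<close>)
    ultimately show ?thesis using 1 2 v by (auto simp: left_kernel_def)
  qed
  have "inj_on h (?N1 \<times> ?N2)"
  proof (rule inj_onI)
    fix x y assume x: "x \<in> ?N1 \<times> ?N2" and y: "y \<in> ?N1 \<times> ?N2" and e: "h x = h y"
    obtain a b a' b' where xy: "x = (a, b)" "y = (a', b')" by (metis surj_pair)
    have s: "pl x = pl y" and dd': "(\<lambda>i. fst x i \<ominus> fst (g (pl x)) i) = (\<lambda>i. fst y i \<ominus> fst (g (pl y)) i)"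
      using arg_cong[OF e, of fst] arg_cong[OF e, of snd] by (simp_all only: h_def fst_conv snd_conv)
    have dd: "a i \<ominus> fst (g (pl x)) i = a' i \<ominus> fst (g (pl x)) i" for i
      using fun_cong[OF dd', of i] by (simp only: s[symmetric]) (simp add: xy)
    have gx: "fst (g (pl x)) i \<in> carrier R" for i using g[OF x] cl by auto
    have aa: "a i = a' i" for i
      using dd[of i] gx[of i] x y cl[of a I1 J1 i] cl[of a' I1 J1 i] xy
      by (metis (no_types, lifting) SigmaD1 a_minus_def add.inv_closed add.right_cancel)
    moreover have "b i = b' i" for i
      using fun_cong[OF s, of i] x y cl[of a I1 J1 i] cl[of b I2 J2 i] cl[of b' I2 J2 i] aa[of i] xy
      by (auto simp: pl_def)
    ultimately show "x = y" by (auto simp: xy)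
  qed
  moreover have "h ` (?N1 \<times> ?N2) \<subseteq> ?U \<times> ?D"
  proof
    fix z assume "z \<in> h ` (?N1 \<times> ?N2)"
    then obtain x where x: "x \<in> ?N1 \<times> ?N2" "z = h x" by blast
    obtain a b a' b' where ab: "x = (a, b)" "g (pl x) = (a', b')" by (metis surj_pair)
    have "(\<lambda>i. a i \<ominus> a' i) \<in> ?D"
      by (rule hD[of a b a' b']) (use g[OF x(1)] x ab in auto)
    thus "z \<in> ?U \<times> ?D" using plU[OF x(1)] x(2) ab by (simp add: h_def)
  qed
  moreover have "finite (?U \<times> ?D)" using assms by (simp add: finite_left_kernel)
  ultimately have "card (?N1 \<times> ?N2) \<le> card (?U \<times> ?D)" by (rule card_inj_on_le)
  thus ?thesis by (simp add: card_cartesian_product)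
qed

text \<open>A new row either is used by no kernel vector, or one vector using it supplies, with its
  multiples, \<open>q\<close> translates of the old kernel. Knowing that cardinalities are powers
  turns a strict inequality between them into a gain of a whole unit in the exponent.\<close>

lemma card_left_kernel_power:
  assumes "finite I" and M: "is_mat M"
  shows "\<exists>n. card (left_kernel I J M) = q ^ n"
  using assms(1)
proof (induction I rule: finite_induct)
  case empty
  have "left_kernel {} J M = {\<lambda>_. \<zero>}"
    by (auto simp: left_kernel_def vecs_def lincomb_def)
  thus ?case by (intro exI[of _ 0]) simp
next
  case (insert r I)
  let ?N = "left_kernel (insert r I) J M" and ?K = "left_kernel I J M"
  have sub: "?K \<subseteq> ?N"
    using insert.hyps by (auto elim!: left_kernel_mono simp: M)
  have N0: "a \<in> ?K" if "a \<in> ?N" "a r = \<zero>" for a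
  proof -
    have v: "a \<in> vecs I" using that by (auto simp: left_kernel_def vecs_def)
    have "lincomb (insert r I) a M j = lincomb I a M j" for j
      by (rule lincomb_neutral) (use insert that vecs_closed[OF v] M v in \<open>auto simp: vecs_def\<close>)
    thus ?thesis using that v by (auto simp: left_kernel_def)
  qed
  have cl: "a i \<in> carrier R" if "a \<in> ?N" for a i
    using that by (rule left_kernel_closed)
  show ?case
  proof (cases "\<exists>a\<in>?N. a r \<noteq> \<zero>")
    case False
    hence eq: "?N = ?K" using sub N0 by blast
    show ?thesis unfolding eq by (rule insert.IH)
  next
    case True
    then obtain a where a: "a \<in> ?N" "a r \<noteq> \<zero>" by blast
    have ar: "a r \<in> Units R" using a cl by (simp add: field_Units)
    have r0: "b r = \<zero>" if "b \<in> ?K" for b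
      using that insert by (auto simp: left_kernel_def vecs_def)
    let ?f = "\<lambda>(t, b) i. t \<otimes> a i \<oplus> \<one> \<otimes> b i"
    have "bij_betw ?f (carrier R \<times> ?K) ?N"
    proof (rule bij_betwI')
      fix x y assume x: "x \<in> carrier R \<times> ?K" and y: "y \<in> carrier R \<times> ?K"
      obtain t b t' b' where xy: "x = (t, b)" "y = (t', b')" by (metis surj_pair)
      show "(?f x = ?f y) = (x = y)"
      proof
        assume e: "?f x = ?f y"
        have "t \<otimes> a r = t' \<otimes> a r"
          using fun_cong[OF e, of r] x y xy r0[of b] r0[of b'] cl[OF a(1), of r] by simp
        hence "t = t'" using ar a x y xy cl[OF a(1), of r] by (metis SigmaD1 m_rcancel)
        moreover have "b i = b' i" for i
          using fun_cong[OF e, of i] x y xy sub cl[OF a(1), of i] cl[of b i] cl[of b' i] \<open>t = t'\<close>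
          by (auto simp: subset_iff)
        ultimately show "x = y" by (auto simp: xy)
      qed simp
    next
      fix x assume "x \<in> carrier R \<times> ?K"
      thus "?f x \<in> ?N" using a(1) sub M by (auto intro!: left_kernel_lin)
    next
      fix b assume b: "b \<in> ?N"
      define t where "t = b r \<otimes> inv (a r)"
      have t: "t \<in> carrier R" using ar cl[OF b] by (simp add: t_def)
      have t1: "t \<otimes> a r = b r" using ar cl[OF b] cl[OF a(1)] by (simp add: t_def m_assoc)
      define b' where "b' = (\<lambda>i. (\<ominus> t) \<otimes> a i \<oplus> \<one> \<otimes> b i)"
      have "b' \<in> ?N" unfolding b'_def by (rule left_kernel_lin) (use a b t M in auto)
      moreover have "b' r = \<zero>" using t t1 cl[OF a(1)] cl[OF b] by (simp add: b'_def l_minus l_neg)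
      ultimately have "b' \<in> ?K" by (rule N0)
      moreover have "b = ?f (t, b')"
        using t cl[OF a(1)] cl[OF b] by (auto simp: b'_def l_minus r_neg2)
      ultimately show "\<exists>x\<in>carrier R \<times> ?K. b = ?f x"
        using t by (intro bexI[of _ "(t, b')"]) auto
    qed
    hence "card ?N = q * card ?K"
      by (simp add: bij_betw_same_card[symmetric] card_cartesian_product q_def)
    moreover obtain n where "card ?K = q ^ n" using insert.IH by blast
    ultimately show ?thesis by (intro exI[of _ "Suc n"]) simp
  qed
qed

end

context finite_field
begin

lemma card_vecs_le:
  assumes "finite A"
  shows "card (vecs A) \<le> q ^ card A"
proof -
  have "card (vecs A) \<le> card (PiE A (\<lambda>_. carrier R))"
  proof (rule card_inj_on_le)
    show "inj_on (\<lambda>a. restrict a A) (vecs A)"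
      by (rule inj_onI, rule ext) (auto simp: vecs_def fun_eq_iff restrict_def, metis)
    show "(\<lambda>a. restrict a A) ` vecs A \<subseteq> PiE A (\<lambda>_. carrier R)" by (auto simp: vecs_def)
    show "finite (PiE A (\<lambda>_. carrier R))" using assms finite_carrier by (simp add: finite_PiE)
  qed
  thus ?thesis using assms by (simp add: card_PiE q_def)
qed

end

section \<open>Row bases\<close>

context field
begin

text \<open>Rows are collected greedily: a row that would spoil independence is a combination of
  those already taken. The form with \<open>y\<close> fits its use: whatever the ports on the source
  side send, the part arriving across a cut is described by \<open>card A\<close>
  coefficients.\<close>

lemma spanning_lin_indep_rows:
  fixes M :: "'r \<Rightarrow> 'c \<Rightarrow> 'a"
  assumes "finite I" and M: "is_mat M"
  shows "\<exists>A \<subseteq> I. lin_indep_rows R J M A \<and>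
    (\<forall>y. (\<forall>i. y i \<in> carrier R) \<longrightarrow> (\<exists>b\<in>vecs A. \<forall>j\<in>J. lincomb I y M j = lincomb A b M j))"
  using assms(1)
proof (induction I rule: finite_induct)
  case empty
  have "lin_indep_rows R J M {}" by (simp add: lin_indep_rows_def)
  moreover have "(\<lambda>_. \<zero>) \<in> vecs {}" by (simp add: vecs_def)
  ultimately show ?case by (intro exI[of _ "{}"]) (auto simp: lincomb_def)
next
  case (insert r I)
  then obtain A where A: "A \<subseteq> I" "lin_indep_rows R J M A" and
    span: "\<And>y. (\<And>i. y i \<in> carrier R) \<Longrightarrow> \<exists>b\<in>vecs A. \<forall>j\<in>J. lincomb I y M j = lincomb A b M j"
    by blast
  have finA: "finite A" and rA: "r \<notin> A" using A(1) insert.hyps finite_subset by auto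
  have split: "lincomb (insert r I) y M j = y r \<otimes> M r j \<oplus> lincomb I y M j"
    if "\<And>i. y i \<in> carrier R" for y j
    by (rule lincomb_insert) (use insert.hyps that M in auto)
  show ?case
  proof (cases "lin_indep_rows R J M (insert r A)")
    case True
    have "\<exists>b\<in>vecs (insert r A). \<forall>j\<in>J. lincomb (insert r I) y M j = lincomb (insert r A) b M j"
      if y: "\<And>i. y i \<in> carrier R" for y
    proof -
      obtain b where b: "b \<in> vecs A" "\<forall>j\<in>J. lincomb I y M j = lincomb A b M j" using span y by blast
      define b' where "b' = b(r := y r)"
      have v: "b' \<in> vecs (insert r A)" using b(1) y by (auto simp: b'_def vecs_def)
      have "lincomb (insert r A) b' M j = y r \<otimes> M r j \<oplus> lincomb A b M j" for j
      proof -
        have "lincomb (insert r A) b' M j = b' r \<otimes> M r j \<oplus> lincomb A b' M j"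
          by (rule lincomb_insert) (use finA rA vecs_closed[OF v] M in auto)
        moreover have "lincomb A b' M j = lincomb A b M j"
          by (rule lincomb_cong) (use rA vecs_closed[OF b(1)] M in \<open>auto simp: b'_def\<close>)
        ultimately show ?thesis by (simp add: b'_def)
      qed
      thus ?thesis using v b(2) split[of y] y by (intro bexI[of _ b']) auto
    qed
    thus ?thesis using True A(1) by (intro exI[of _ "insert r A"]) blast
  next
    case False
    then obtain a i where a: "a \<in> left_kernel (insert r A) J M" "a i \<noteq> \<zero>"
      using lin_indep_rows_iff[OF M] by blast
    note ca = left_kernel_closed[OF a(1)]
    have asplit: "lincomb (insert r A) a M j = a r \<otimes> M r j \<oplus> lincomb A a M j" for j
      by (rule lincomb_insert) (use finA rA ca M in auto)
    have lc: "lincomb A a M j \<in> carrier R" for j by (rule lincomb_closed) (use ca M in auto)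
    have az: "a r \<otimes> M r j \<oplus> lincomb A a M j = \<zero>" if "j \<in> J" for j
      using a(1) asplit[of j] that by (simp add: left_kernel_def)
    \<comment> \<open>A relation that does not use row \<open>r\<close> would contradict the
      independence of \<open>A\<close>; hence the relation can be solved for row
      \<open>r\<close>.\<close>
    have ar: "a r \<noteq> \<zero>"
    proof
      assume z: "a r = \<zero>"
      have "a \<in> vecs A"
        unfolding vecs_def using a(1) ca z by (auto simp: left_kernel_def vecs_def) (metis z)
      hence "a \<in> left_kernel A J M" using az lc M z by (auto simp: left_kernel_def)
      thus False using lin_indep_rowsD[OF A(2) _ M] a(2) by blast
    qed
    define u where "u = inv (a r)"
    have u: "u \<in> carrier R" "u \<otimes> a r = \<one>" using ar ca[of r] by (auto simp: u_def field_Units)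
    have row: "M r j = (\<ominus> u) \<otimes> lincomb A a M j" if j: "j \<in> J" for j
    proof -
      have "u \<otimes> (a r \<otimes> M r j \<oplus> lincomb A a M j) = (u \<otimes> a r) \<otimes> M r j \<oplus> u \<otimes> lincomb A a M j"
        using u(1) ca[of r] lc[of j] is_matD[OF M, of r j] by (simp add: r_distr m_assoc)
      hence "M r j \<oplus> u \<otimes> lincomb A a M j = \<zero>" using az[OF j] u is_matD[OF M, of r j] by simp
      thus ?thesis using u(1) lc[of j] is_matD[OF M, of r j]
        by (metis l_minus m_closed minus_equality)
    qed
    have "\<exists>b\<in>vecs A. \<forall>j\<in>J. lincomb (insert r I) y M j = lincomb A b M j"
      if y: "\<And>i. y i \<in> carrier R" for y
    proof -
      obtain b where b: "b \<in> vecs A" "\<forall>j\<in>J. lincomb I y M j = lincomb A b M j" using span y by blast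
      define a' where "a' = a(r := \<zero>)"
      have va: "a' \<in> vecs A" using a(1) by (auto simp: a'_def left_kernel_def vecs_def)
      have la: "lincomb A a' M j = lincomb A a M j" for j
        by (rule lincomb_cong) (use rA ca M in \<open>auto simp: a'_def\<close>)
      define b' where "b' = (\<lambda>i. y r \<otimes> \<ominus> u \<otimes> a' i \<oplus> \<one> \<otimes> b i)"
      have v: "b' \<in> vecs A" unfolding b'_def by (rule vecs_lin) (use va b y u in auto)
      have "lincomb A b' M j = y r \<otimes> \<ominus> u \<otimes> lincomb A a' M j \<oplus> \<one> \<otimes> lincomb A b M j" for j
        unfolding b'_def
        by (rule lincomb_lin) (use vecs_closed[OF va] vecs_closed[OF b(1)] y u M in auto)
      moreover have "lincomb A b M j \<in> carrier R" for j
        by (rule lincomb_closed) (use vecs_closed[OF b(1)] M in auto)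
      ultimately have "lincomb (insert r I) y M j = lincomb A b' M j" if j: "j \<in> J" for j
        using b(2) j split[of y j] y row[OF j] la[of j] lc[of j] u(1) by (simp add: m_assoc)
      thus ?thesis using v by blast
    qed
    thus ?thesis using A by (intro exI[of _ A]) blast
  qed
qed

end

section \<open>Matrices with free entries\<close>

definition fill :: "('r \<times> 'c) set \<Rightarrow> ('r \<Rightarrow> 'c \<Rightarrow> 'a) \<Rightarrow> ('r \<Rightarrow> 'c \<Rightarrow> 'a) \<Rightarrow> 'r \<Rightarrow> 'c \<Rightarrow> 'a" where
  "fill Z c M r j = (if (r, j) \<in> Z then c r j else M r j)"

definition upd_entry :: "('r \<Rightarrow> 'c \<Rightarrow> 'a) \<Rightarrow> 'r \<Rightarrow> 'c \<Rightarrow> 'a \<Rightarrow> 'r \<Rightarrow> 'c \<Rightarrow> 'a" where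
  "upd_entry M r k t = (\<lambda>r' j. if r' = r \<and> j = k then t else M r' j)"

context field
begin

lemma upd_entry_closed: "is_mat M \<Longrightarrow> t \<in> carrier R \<Longrightarrow> is_mat (upd_entry M r k t)"
  by (simp add: upd_entry_def is_mat_def)

lemma lincomb_upd_entry:
  fixes M :: "'r \<Rightarrow> 'c \<Rightarrow> 'a"
  assumes "finite I" "r \<in> I" "\<And>i. i \<in> I \<Longrightarrow> a i \<in> carrier R" and M: "is_mat M"
    and t: "t \<in> carrier R"
  shows "lincomb I a (upd_entry M r k t) j =
    (if j = k then a r \<otimes> t \<oplus> lincomb (I - {r}) a M k else lincomb I a M j)"
proof -
  have I: "I = insert r (I - {r})" using assms by blast
  have "lincomb I a (upd_entry M r k t) k = a r \<otimes> t \<oplus> lincomb (I - {r}) a (upd_entry M r k t) k"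
    using lincomb_insert[of "I - {r}" r a "upd_entry M r k t" k] assms I
    by (simp add: upd_entry_closed insert_absorb) (simp add: upd_entry_def)
  moreover have "lincomb (I - {r}) a (upd_entry M r k t) k = lincomb (I - {r}) a M k"
    by (rule lincomb_cong) (use assms in \<open>auto simp: upd_entry_def\<close>)
  moreover have "lincomb I a (upd_entry M r k t) j = lincomb I a M j" if "j \<noteq> k"
    by (rule lincomb_cong) (use assms that in \<open>auto simp: upd_entry_def\<close>)
  ultimately show ?thesis by auto
qed

lemma lincomb_upd_entry_notin:
  assumes "r \<notin> I \<or> j \<noteq> k" "\<And>i. i \<in> I \<Longrightarrow> a i \<in> carrier R" "is_mat M"
  shows "lincomb I a (upd_entry M r k t) j = lincomb I a M j"
  by (rule lincomb_cong) (use assms in \<open>auto simp: upd_entry_def\<close>)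

text \<open>The product is affine in the changed entry, with slope \<open>a r\<close>. A kernel
  vector for the value \<open>t\<close> can therefore fail at the value \<open>s\<close> only in
  column \<open>k\<close>, by \<open>a r\<close> times the change.\<close>

lemma lincomb_upd_entry_kernel:
  fixes M :: "'r \<Rightarrow> 'c \<Rightarrow> 'a"
  assumes fin: "finite I" and r: "r \<in> I" and M: "is_mat M"
    and t: "t \<in> carrier R" "s \<in> carrier R" and a: "a \<in> left_kernel I J (upd_entry M r k t)"
    and j: "j \<in> J"
  shows "lincomb I a (upd_entry M r k s) j = (if j = k then a r \<otimes> (s \<ominus> t) else \<zero>)"
proof -
  note ca = left_kernel_closed[OF a]
  have z: "lincomb I a (upd_entry M r k t) j = \<zero>" using a j by (simp add: left_kernel_def)
  show ?thesis
  proof (cases "j = k")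
    case True
    define L where "L = lincomb (I - {r}) a M k"
    have L: "L \<in> carrier R" unfolding L_def by (rule lincomb_closed) (use ca M in auto)
    have "a r \<otimes> t \<oplus> L = \<zero>"
      using z lincomb_upd_entry[OF fin r _ M t(1), where a=a and j=j] ca True by (simp add: L_def)
    hence "L = \<ominus> (a r \<otimes> t)"
      using L ca t by (metis add.inv_closed add.m_comm m_closed minus_equality minus_minus)
    moreover have "lincomb I a (upd_entry M r k s) j = a r \<otimes> s \<oplus> L"
      using lincomb_upd_entry[OF fin r _ M t(2), where a=a and j=j] ca True by (simp add: L_def)
    ultimately have "lincomb I a (upd_entry M r k s) j = a r \<otimes> s \<oplus> \<ominus> (a r \<otimes> t)" by simp
    also have "\<dots> = a r \<otimes> (s \<ominus> t)" using ca[of r] t by algebra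
    finally show ?thesis using True by simp
  next
    case False
    thus ?thesis
      using z lincomb_upd_entry[OF fin r _ M t(1), where a=a and j=j] lincomb_upd_entry[OF fin r _ M t(2), where a=a and j=j] ca
      by simp
  qed
qed

lemma dependent_at_obtain:
  assumes M: "is_mat M" and u: "u \<in> carrier R"
    and d: "\<not> lin_indep_rows R J (upd_entry M r k u) I"
  obtains a i where "a \<in> left_kernel I J (upd_entry M r k u)" "a i \<noteq> \<zero>"
proof -
  show ?thesis using d that lin_indep_rows_iff[OF upd_entry_closed[OF M u]] by blast
qed

lemma left_kernel_upd_entry_zero:
  assumes fin: "finite I" and r: "r \<in> I" and M: "is_mat M"
    and t: "t \<in> carrier R" "s \<in> carrier R" and a: "a \<in> left_kernel I J (upd_entry M r k t)"
    and z: "a r = \<zero>"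
  shows "a \<in> left_kernel I J (upd_entry M r k s)"
proof -
  have "lincomb I a (upd_entry M r k s) j = \<zero>" if "j \<in> J" for j
    using lincomb_upd_entry_kernel[OF fin r M t a that] z t by simp
  thus ?thesis using a by (simp add: left_kernel_def)
qed

lemma left_kernel_upd_entry_delete:
  assumes fin: "finite I" and M: "is_mat M"
    and t: "t \<in> carrier R" and v: "a \<in> vecs I"
    and a: "\<And>j. j \<in> J - {k} \<Longrightarrow> lincomb I a (upd_entry M r k t) j = \<zero>"
    and z: "a r = \<zero>"
  shows "a \<in> left_kernel (I - {r}) (J - {k}) M"
proof -
  have v': "a \<in> vecs (I - {r})" using v z by (auto simp: vecs_def)
  have "lincomb (I - {r}) a M j = \<zero>" if j: "j \<in> J - {k}" for j
  proof -
    have "lincomb (I - {r}) a M j = lincomb I a M j"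
      by (rule lincomb_neutral[symmetric]) (use fin vecs_closed[OF v] M z in auto)
    also have "\<dots> = lincomb I a (upd_entry M r k t) j"
      by (rule lincomb_upd_entry_notin[symmetric]) (use j vecs_closed[OF v] M in auto)
    finally show ?thesis using a j by simp
  qed
  thus ?thesis using v' by (simp add: left_kernel_def)
qed

text \<open>For a square matrix the determinant is affine in one entry, with the complementary minor
  as slope up to sign, so two zeros kill slope and constant term. Here the numbers of rows and
  columns may differ, and kernel vectors for the two values are combined instead.\<close>

lemma dependent_at_two_values:
  fixes M :: "'r \<Rightarrow> 'c \<Rightarrow> 'a"
  assumes fin: "finite I" and rk: "r \<in> I" "k \<in> J" and M: "is_mat M"
    and t: "t \<in> carrier R" "t' \<in> carrier R" "t \<noteq> t'"
    and dep: "\<not> lin_indep_rows R J (upd_entry M r k t) I"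
      "\<not> lin_indep_rows R J (upd_entry M r k t') I"
  shows "\<not> lin_indep_rows R (J - {k}) M (I - {r})"
    and "s \<in> carrier R \<Longrightarrow> \<not> lin_indep_rows R J (upd_entry M r k s) I"
proof -
  obtain a i where a: "a \<in> left_kernel I J (upd_entry M r k t)" "a i \<noteq> \<zero>"
    using dependent_at_obtain[OF M t(1) dep(1)] .
  obtain a' i' where a': "a' \<in> left_kernel I J (upd_entry M r k t')" "a' i' \<noteq> \<zero>"
    using dependent_at_obtain[OF M t(2) dep(2)] .
  note ca = left_kernel_closed[OF a(1)] and ca' = left_kernel_closed[OF a'(1)]
  have va: "a \<in> vecs I" "a' \<in> vecs I" using a a' by (auto simp: left_kernel_def)
  have tt: "t' \<ominus> t \<noteq> \<zero>" "t \<ominus> t' \<noteq> \<zero>" using t by simp_all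
  have comb: "lincomb I (\<lambda>i. l \<otimes> a i \<oplus> m \<otimes> a' i) (upd_entry M r k s) j
      = (if j = k then l \<otimes> (a r \<otimes> (s \<ominus> t)) \<oplus> m \<otimes> (a' r \<otimes> (s \<ominus> t')) else \<zero>)"
    if "l \<in> carrier R" "m \<in> carrier R" "s \<in> carrier R" "j \<in> J" for l m s j
  proof -
    have "lincomb I (\<lambda>i. l \<otimes> a i \<oplus> m \<otimes> a' i) (upd_entry M r k s) j
        = l \<otimes> lincomb I a (upd_entry M r k s) j \<oplus> m \<otimes> lincomb I a' (upd_entry M r k s) j"
      by (rule lincomb_lin) (use that ca ca' in \<open>auto intro: upd_entry_closed[OF M]\<close>)
    thus ?thesis
      using that lincomb_upd_entry_kernel[OF fin rk(1) M t(1) that(3) a(1) that(4)]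
        lincomb_upd_entry_kernel[OF fin rk(1) M t(2) that(3) a'(1) that(4)] by simp
  qed
  show "\<not> lin_indep_rows R (J - {k}) M (I - {r})"
  proof
    assume "lin_indep_rows R (J - {k}) M (I - {r})"
    note ind = lin_indep_rowsD[OF this _ M]
    have "a r \<noteq> \<zero>"
      using ind[OF left_kernel_upd_entry_delete[OF fin M t(1) va(1)]] a by (auto simp: left_kernel_def)
    have "a' r \<noteq> \<zero>"
      using ind[OF left_kernel_upd_entry_delete[OF fin M t(2) va(2)]] a' by (auto simp: left_kernel_def)
    \<comment> \<open>Coordinate \<open>r\<close> cancels, so the vector survives the deletion of
      row \<open>r\<close>; its defect in column \<open>k\<close> at the value \<open>t'\<close> is
      a product of nonzero factors, so it is not zero.\<close>
    define b where "b = (\<lambda>i. a' r \<otimes> a i \<oplus> (\<ominus> a r) \<otimes> a' i)"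
    have "b r = \<zero>" using ca[of r] ca'[of r] unfolding b_def by algebra
    moreover have "b \<in> vecs I" unfolding b_def by (rule vecs_lin) (use va ca ca' in auto)
    moreover have bj: "lincomb I b (upd_entry M r k t') j = (if j = k then a' r \<otimes> (a r \<otimes> (t' \<ominus> t)) else \<zero>)"
      if "j \<in> J" for j
      unfolding b_def using comb[of "a' r" "\<ominus> a r" t' j] that ca[of r] ca'[of r] t r_neg[OF t(2)]
      by (simp add: a_minus_def)
    ultimately have "b \<in> left_kernel (I - {r}) (J - {k}) M"
      by (intro left_kernel_upd_entry_delete[OF fin M t(2), where r = r and k = k]) auto
    hence b0: "b i = \<zero>" for i by (rule ind)
    have "lincomb I b (upd_entry M r k t') k = \<zero>"
      unfolding lincomb_def b0 by (rule add.finprod_one_eqI) (use M t in \<open>simp add: upd_entry_closed\<close>)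
    thus False using bj[OF rk(2)] \<open>a r \<noteq> \<zero>\<close> \<open>a' r \<noteq> \<zero>\<close> tt(1) ca[of r] ca'[of r] t
      by (simp add: integral_iff)
  qed
  show "\<not> lin_indep_rows R J (upd_entry M r k s) I" if s: "s \<in> carrier R"
  proof
    assume "lin_indep_rows R J (upd_entry M r k s) I"
    note ind = lin_indep_rowsD[OF this _ upd_entry_closed[OF M s]]
    have "a r \<noteq> \<zero>"
      using ind[OF left_kernel_upd_entry_zero[OF fin rk(1) M t(1) s a(1)]] a by blast
    have "a' r \<noteq> \<zero>"
      using ind[OF left_kernel_upd_entry_zero[OF fin rk(1) M t(2) s a'(1)]] a' by blast
    \<comment> \<open>The weights cancel the defects that \<open>a\<close> and \<open>a'\<close>
      leave in column \<open>k\<close> at the value \<open>s\<close>; coordinate \<open>r\<close>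
      stays nonzero because \<open>t\<close> and \<open>t'\<close> differ.\<close>
    define l where "l = a' r \<otimes> (s \<ominus> t')"
    define m where "m = \<ominus> (a r \<otimes> (s \<ominus> t))"
    have lm: "l \<in> carrier R" "m \<in> carrier R" using ca ca' s t by (auto simp: l_def m_def)
    define b where "b = (\<lambda>i. l \<otimes> a i \<oplus> m \<otimes> a' i)"
    have "l \<otimes> (a r \<otimes> (s \<ominus> t)) \<oplus> m \<otimes> (a' r \<otimes> (s \<ominus> t')) = \<zero>"
      unfolding l_def m_def using ca[of r] ca'[of r] s t by algebra
    hence "b \<in> left_kernel I J (upd_entry M r k s)"
      using comb[OF lm s] vecs_lin[OF va lm] by (simp add: left_kernel_def b_def)
    hence "b r = \<zero>" by (rule ind)
    moreover have "b r = a r \<otimes> a' r \<otimes> (t \<ominus> t')"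
      unfolding b_def l_def m_def using ca[of r] ca'[of r] s t by algebra
    ultimately show False using \<open>a r \<noteq> \<zero>\<close> \<open>a' r \<noteq> \<zero>\<close> tt(2) ca[of r] ca'[of r] t
      by (simp add: integral_iff)
  qed
qed

end

lemma fill_insert: "(r, k) \<notin> Z \<Longrightarrow> fill (insert (r, k) Z) c M = upd_entry (fill Z c M) r k (c r k)"
  by (auto simp: fill_def upd_entry_def fun_eq_iff)

context ring
begin

lemma fill_closed: "is_mat M \<Longrightarrow> is_mat c \<Longrightarrow> is_mat (fill Z c M)"
  by (simp add: fill_def is_mat_def)

lemma left_kernel_cong:
  assumes "\<And>i j. i \<in> I \<Longrightarrow> j \<in> J \<Longrightarrow> M i j = M' i j" "is_mat M'"
  shows "left_kernel I J M = left_kernel I J M'"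
proof -
  have "lincomb I a M j = lincomb I a M' j" if "a \<in> vecs I" "j \<in> J" for a j
    by (rule lincomb_cong) (use assms that vecs_closed in auto)
  thus ?thesis by (auto simp: left_kernel_def)
qed

end

section \<open>Obstructions to filling, and fillings common to several row sets\<close>

context finite_field
begin

text \<open>Hartfiel--Loewy, by induction on the number of free entries: the obstruction obtained with one
  entry fixed is uncrossed with the one obtained by deleting the row and column of that entry.\<close>

lemma fill_obstruction:
  assumes "finite Z" "finite I" "finite J" "is_mat M"
    and "\<And>c. is_mat c \<Longrightarrow> \<not> lin_indep_rows R J (fill Z c M) I"
  shows "\<exists>I' J'. I' \<subseteq> I \<and> J' \<subseteq> J \<and> (I' \<times> J') \<inter> Z = {} \<and>
    card (left_kernel I' J' M) > q ^ card (J - J')"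
  using assms
proof (induction Z arbitrary: I J rule: finite_induct)
  case empty
  have "fill {} c M = M" for c by (simp add: fill_def fun_eq_iff)
  hence "\<not> lin_indep_rows R J M I" using empty.prems(3) empty.prems(4)[of M] by simp
  then obtain a i where a: "a \<in> left_kernel I J M" "a i \<noteq> \<zero>"
    using lin_indep_rows_iff[OF empty.prems(3)] by blast
  have "card {a, \<lambda>_. \<zero>} \<le> card (left_kernel I J M)"
    by (rule card_mono) (use a empty.prems zero_in_left_kernel in \<open>auto simp: finite_left_kernel\<close>)
  moreover have "a \<noteq> (\<lambda>_. \<zero>)" using a(2) by auto
  ultimately have "card (left_kernel I J M) > q ^ card (J - J)" by simp
  thus ?case by (intro exI[of _ I] exI[of _ J]) simp
next
  case (insert z Z)
  obtain r k where z: "z = (r, k)" by (cases z)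
  note rkZ = insert.hyps(2)[unfolded z] and M = insert.prems(3)
  have dep: "\<not> lin_indep_rows R J (upd_entry (fill Z c M) r k t) I"
    if "is_mat c" "t \<in> carrier R" for c t
  proof -
    have "upd_entry (fill Z c M) r k t = fill (insert z Z) (upd_entry c r k t) M"
      using rkZ by (auto simp: fill_def upd_entry_def fun_eq_iff z)
    thus ?thesis using insert.prems(4) upd_entry_closed[OF that] by simp
  qed
  \<comment> \<open>Freezing the entry at the value it already has in \<open>M\<close> removes a
    free entry without changing \<open>M\<close>, so the obstruction obtained is one for
    \<open>M\<close> itself.\<close>
  have "\<not> lin_indep_rows R J (fill Z c M) I" if "is_mat c" for c
  proof -
    have "upd_entry (fill Z c M) r k (M r k) = fill Z c M"
      using rkZ by (auto simp: fill_def upd_entry_def fun_eq_iff)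
    thus ?thesis using dep[OF that, of "M r k"] M by simp
  qed
  then obtain I1 J1 where 1: "I1 \<subseteq> I" "J1 \<subseteq> J" "(I1 \<times> J1) \<inter> Z = {}"
      "card (left_kernel I1 J1 M) > q ^ card (J - J1)"
    using insert.IH[OF insert.prems(1,2,3)] by blast
  show ?case
  proof (cases "r \<in> I1 \<and> k \<in> J1")
    case False
    thus ?thesis using 1 by (intro exI[of _ I1] exI[of _ J1]) (auto simp: z)
  next
    case True
    hence rk: "r \<in> I" "k \<in> J" using 1 by auto
    \<comment> \<open>Zero and one serve as the two dependent values, so no lower bound on
      \<open>q\<close> is involved.\<close>
    have "\<not> lin_indep_rows R (J - {k}) (fill Z c M) (I - {r})" if "is_mat c" for c
      by (rule dependent_at_two_values(1)[OF insert.prems(1) rk fill_closed[OF M that], of \<zero> \<one>])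
        (use dep[OF that] in auto)
    then obtain I2 J2 where 2: "I2 \<subseteq> I - {r}" "J2 \<subseteq> J - {k}" "(I2 \<times> J2) \<inter> Z = {}"
        "card (left_kernel I2 J2 M) > q ^ card (J - {k} - J2)"
      using insert.IH[OF _ _ insert.prems(3), of "I - {r}" "J - {k}"] insert.prems(1,2) by blast
    have fin: "finite I1" "finite I2" "finite J1" "finite J2"
      using 1 2 insert.prems(1,2) by (meson finite_subset finite_Diff)+
    obtain n1 where n1: "card (left_kernel I1 J1 M) = q ^ n1"
      using card_left_kernel_power[OF fin(1) M] by blast
    obtain n2 where n2: "card (left_kernel I2 J2 M) = q ^ n2"
      using card_left_kernel_power[OF fin(2) M] by blast
    obtain nu where nu: "card (left_kernel (I1 \<union> I2) (J1 \<inter> J2) M) = q ^ nu"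
      using card_left_kernel_power[of "I1 \<union> I2"] fin M by blast
    obtain nd where nd: "card (left_kernel (I1 \<inter> I2) (J1 \<union> J2) M) = q ^ nd"
      using card_left_kernel_power[of "I1 \<inter> I2"] fin M by blast
    have "q ^ (n1 + n2) \<le> q ^ (nu + nd)"
      using card_left_kernel_uncross[OF fin(1,2) M, of J1 J2] by (simp add: n1 n2 nu nd power_add)
    hence le: "n1 + n2 \<le> nu + nd" using q_gt_1 by simp
    have "n1 > card (J - J1)" using 1(4) q_gt_1 by (simp add: n1)
    moreover have "n2 > card (J - {k} - J2)" using 2(4) q_gt_1 by (simp add: n2)
    \<comment> \<open>The deleted column costs one in the second bound, but two strict inequalities
      between exponents gain two. A surplus of one remains, and must show up in one of the two
      uncrossed blocks.\<close>
    moreover have "card (J - J2) = Suc (card (J - {k} - J2))"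
    proof -
      have "J - J2 = insert k (J - {k} - J2)" using rk 2 by auto
      thus ?thesis using insert.prems(2) by simp
    qed
    moreover have "card (J - J1) + card (J - J2) = card (J - J1 \<inter> J2) + card (J - (J1 \<union> J2))"
      using card_Un_Int[of "J - J1" "J - J2"] insert.prems(2) by (simp add: Diff_Int Diff_Un)
    ultimately have "nu > card (J - J1 \<inter> J2) \<or> nd > card (J - (J1 \<union> J2))" using le by linarith
    thus ?thesis
    proof
      assume "nu > card (J - J1 \<inter> J2)"
      hence "card (left_kernel (I1 \<union> I2) (J1 \<inter> J2) M) > q ^ card (J - J1 \<inter> J2)"
        using q_gt_1 by (simp add: nu)
      \<comment> \<open>Each uncrossed block is covered by the two old ones, so it avoids
        \<open>Z\<close>. It also avoids the new entry: here because \<open>k\<close> is missing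
        from \<open>J2\<close>, in the other case because \<open>r\<close> is missing from
        \<open>I2\<close>.\<close>
      thus ?thesis using 1 2 z by (intro exI[of _ "I1 \<union> I2"] exI[of _ "J1 \<inter> J2"]) auto
    next
      assume "nd > card (J - (J1 \<union> J2))"
      hence "card (left_kernel (I1 \<inter> I2) (J1 \<union> J2) M) > q ^ card (J - (J1 \<union> J2))"
        using q_gt_1 by (simp add: nd)
      thus ?thesis using 1 2 z by (intro exI[of _ "I1 \<inter> I2"] exI[of _ "J1 \<union> J2"]) auto
    qed
  qed
qed

text \<open>Entries are fixed one at a time and absorbed into \<open>M\<close>. The invariant is
  that each row set by itself can still be completed, possibly by its own filling; once no entry is
  free, these fillings all give the same matrix. Each \<open>n\<close> excludes at most one value of
  an entry, so \<open>card A < q\<close> leaves a value acceptable to all.\<close>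

lemma common_fill:
  assumes "finite Z" "finite A" "card A < q" "\<And>n. n \<in> A \<Longrightarrow> finite (I n)" "is_mat M"
    and "\<And>n. n \<in> A \<Longrightarrow> \<exists>c. is_mat c \<and> lin_indep_rows R J (fill Z c M) (I n)"
  shows "\<exists>c. is_mat c \<and> (\<forall>n\<in>A. lin_indep_rows R J (fill Z c M) (I n))"
  using assms(1,5,6)
proof (induction Z arbitrary: M rule: finite_induct)
  case empty
  have "fill {} c M = M" for c by (simp add: fill_def fun_eq_iff)
  thus ?case using empty by auto
next
  case (insert z Z)
  obtain r k where z: "z = (r, k)" by (cases z)
  note rkZ = insert.hyps(2)[unfolded z] and M = insert.prems(1)
  define good where "good n t \<longleftrightarrow> (\<exists>c. is_mat c \<and> lin_indep_rows R J (fill Z c (upd_entry M r k t)) (I n))" for n t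
  have swap: "fill Z c (upd_entry M r k t) = upd_entry (fill Z c M) r k t" for c t
    using rkZ by (auto simp: fill_def upd_entry_def fun_eq_iff)
  have bad: "card {t \<in> carrier R. \<not> good n t} \<le> 1" if n: "n \<in> A" for n
  proof -
    obtain c where c: "is_mat c" "lin_indep_rows R J (fill (insert z Z) c M) (I n)"
      using insert.prems(2)[OF n] by blast
    have ind: "lin_indep_rows R J (upd_entry (fill Z c M) r k (c r k)) (I n)"
      using c(2) unfolding z fill_insert[OF rkZ] .
    \<comment> \<open>A completion \<open>c\<close> that works for \<open>n\<close> is kept at all
      other entries. Two excluded values would make it dependent at both, hence also at its own
      value \<open>c r k\<close>.\<close>
    have "t = t'" if t: "t \<in> carrier R" "t' \<in> carrier R" and nt: "\<not> good n t" "\<not> good n t'" for t t'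
    proof (rule ccontr)
      assume ne: "t \<noteq> t'"
      have d: "\<not> lin_indep_rows R J (upd_entry (fill Z c M) r k t) (I n)"
        "\<not> lin_indep_rows R J (upd_entry (fill Z c M) r k t') (I n)"
        using nt c(1) unfolding good_def swap by auto
      note fc = fill_closed[OF M c(1), of Z]
      show False
      proof (cases "r \<in> I n \<and> k \<in> J")
        case True
        thus False
          using dependent_at_two_values(2)[OF assms(4)[OF n] _ _ fc t ne d, of "c r k"] ind c(1) by simp
      next
        case False
        have ck: "c r k \<in> carrier R" using c(1) by simp
        have "left_kernel (I n) J (upd_entry (fill Z c M) r k (c r k))
            = left_kernel (I n) J (upd_entry (fill Z c M) r k t)"
          by (rule left_kernel_cong) (use False upd_entry_closed[OF fc t(1)] in \<open>auto simp: upd_entry_def\<close>)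
        thus False using d(1) ind lin_indep_rows_iff[OF upd_entry_closed[OF fc t(1)]]
          lin_indep_rows_iff[OF upd_entry_closed[OF fc ck]] by blast
      qed
    qed
    moreover have "finite {t \<in> carrier R. \<not> good n t}" using finite_carrier by simp
    ultimately show ?thesis using card_le_Suc0_iff_eq[of "{t \<in> carrier R. \<not> good n t}"] by auto
  qed
  have "card (\<Union>n\<in>A. {t \<in> carrier R. \<not> good n t}) \<le> (\<Sum>n\<in>A. card {t \<in> carrier R. \<not> good n t})"
    by (rule card_UN_le) (rule assms)
  also have "\<dots> \<le> (\<Sum>n\<in>A. 1)" by (rule sum_mono) (rule bad)
  also have "\<dots> < card (carrier R)" using assms(3) by (simp add: q_def)
  finally have "(\<Union>n\<in>A. {t \<in> carrier R. \<not> good n t}) \<noteq> carrier R" by auto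
  then obtain t where t: "t \<in> carrier R" "\<forall>n\<in>A. good n t" by blast
  have "\<exists>c. is_mat c \<and> (\<forall>n\<in>A. lin_indep_rows R J (fill Z c (upd_entry M r k t)) (I n))"
    by (rule insert.IH) (use upd_entry_closed[OF M] t in \<open>auto simp: good_def\<close>)
  then obtain c where c: "is_mat c" "\<forall>n\<in>A. lin_indep_rows R J (fill Z c (upd_entry M r k t)) (I n)"
    by blast
  have "fill Z c (upd_entry M r k t) = fill (insert z Z) (upd_entry c r k t) M"
    using rkZ by (auto simp: fill_def upd_entry_def fun_eq_iff z)
  thus ?case using c upd_entry_closed[OF c(1) t(1)] by metis
qed

end

section \<open>Right inverses and change of field\<close>

context field
begin

lemma lincomb_delta:
  assumes "finite J" "j0 \<in> J" "is_mat M"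
  shows "lincomb J (\<lambda>j. if j = j0 then \<one> else \<zero>) M x = M j0 x"
proof -
  have "lincomb J (\<lambda>j. if j = j0 then \<one> else \<zero>) M x = (\<Oplus>j\<in>J. if j0 = j then M j x else \<zero>)"
    unfolding lincomb_def by (rule finsum_cong') (use assms in auto)
  also have "\<dots> = M j0 x" by (rule finsum_singleton) (use assms in auto)
  finally show ?thesis .
qed

text \<open>Independence concerns all coefficient vectors, whereas a right inverse is a finite set
  of equations: these pass through ring homomorphisms, and they yield decoders. \<open>Z s\<close>
  is the column of the inverse dual to row \<open>s\<close>.\<close>

lemma right_inverse_exists:
  fixes M :: "'r \<Rightarrow> 'c \<Rightarrow> 'a"
  assumes "finite A" and J: "finite J" and M: "is_mat M" and "lin_indep_rows R J M A"
  shows "\<exists>Z. is_mat Z \<and> (\<forall>s\<in>A. \<forall>x\<in>A. lincomb J (Z s) (\<lambda>j x. M x j) x = (if s = x then \<one> else \<zero>))"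
  using assms(1,4)
proof (induction A rule: finite_induct)
  case empty
  show ?case by (intro exI[of _ "\<lambda>_ _. \<zero>"]) (simp add: is_mat_def)
next
  case (insert r A)
  let ?MT = "\<lambda>j x. M x j"
  have MT: "is_mat ?MT" using M by (simp add: is_mat_def)
  have "lin_indep_rows R J M A"
    unfolding lin_indep_rows_iff[OF M]
  proof (intro ballI allI)
    fix a i assume "a \<in> left_kernel A J M"
    hence "a \<in> left_kernel (insert r A) J M"
      by (rule left_kernel_mono) (use insert.hyps M in auto)
    thus "a i = \<zero>" by (rule lin_indep_rowsD[OF insert.prems _ M])
  qed
  then obtain Z where Z: "is_mat Z"
      "\<And>s x. s \<in> A \<Longrightarrow> x \<in> A \<Longrightarrow> lincomb J (Z s) ?MT x = (if s = x then \<one> else \<zero>)"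
    using insert.IH by blast
  define d where "d = (\<lambda>s. lincomb J (Z s) ?MT r)"
  have d_app: "lincomb J (Z s) ?MT r = d s" for s by (simp add: d_def)
  have d: "d s \<in> carrier R" for s unfolding d_def by (rule lincomb_closed) (use Z(1) MT in auto)
  \<comment> \<open>The unit vector at \<open>j0\<close>, corrected so that it pairs to zero with
    the rows in \<open>A\<close>.\<close>
  define u where "u j0 = (\<lambda>j. \<one> \<otimes> (if j = j0 then \<one> else \<zero>) \<oplus> (\<ominus> \<one>) \<otimes> lincomb A (\<lambda>s. M s j0) Z j)" for j0
  have lc: "lincomb A (\<lambda>s. M s j0) Z j \<in> carrier R" for j0 j
    by (rule lincomb_closed) (use Z(1) M in auto)
  have u: "u j0 j \<in> carrier R" for j0 j using lc by (auto simp: u_def)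
  have uM: "lincomb J (u j0) ?MT x = M x j0 \<oplus> \<ominus> lincomb A (\<lambda>s. M s j0) (\<lambda>s. lincomb J (Z s) ?MT) x"
    if j0: "j0 \<in> J" for j0 x
  proof -
    have "lincomb J (u j0) ?MT x = \<one> \<otimes> lincomb J (\<lambda>j. if j = j0 then \<one> else \<zero>) ?MT x
        \<oplus> (\<ominus> \<one>) \<otimes> lincomb J (lincomb A (\<lambda>s. M s j0) Z) ?MT x"
      unfolding u_def by (rule lincomb_lin) (use lc MT in auto)
    also have "lincomb J (\<lambda>j. if j = j0 then \<one> else \<zero>) ?MT x = M x j0"
      by (rule lincomb_delta) (use J j0 MT in auto)
    also have "lincomb J (lincomb A (\<lambda>s. M s j0) Z) ?MT x
        = lincomb A (\<lambda>s. M s j0) (\<lambda>s. lincomb J (Z s) ?MT) x"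
      by (rule lincomb_lincomb) (use insert.hyps J Z(1) M MT in auto)
    finally show ?thesis
      using M lincomb_closed[of A "\<lambda>s. M s j0" "\<lambda>s. lincomb J (Z s) ?MT" x]
        lincomb_closed[of J _ ?MT] Z(1) MT by (simp add: is_mat_def l_minus)
  qed
  have uA: "lincomb J (u j0) ?MT x = \<zero>" if "j0 \<in> J" "x \<in> A" for j0 x
  proof -
    have "lincomb A (\<lambda>s. M s j0) (\<lambda>s. lincomb J (Z s) ?MT) x
        = (\<Oplus>s\<in>A. if x = s then M s j0 else \<zero>)"
      unfolding lincomb_def[of A] by (rule finsum_cong') (use Z M that in auto)
    also have "\<dots> = M x j0" by (rule finsum_singleton) (use that M insert.hyps in auto)
    finally show ?thesis using uM[OF that(1), of x] M by (simp add: r_neg)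
  qed
  have "\<exists>j0\<in>J. lincomb J (u j0) ?MT r \<noteq> \<zero>"
  proof (rule ccontr)
    assume "\<not> ?thesis"
    hence z: "lincomb J (u j) ?MT r = \<zero>" if "j \<in> J" for j using that by blast
    \<comment> \<open>If every corrected unit vector also pairs to zero with row \<open>r\<close>,
      then row \<open>r\<close> is the combination of the rows in \<open>A\<close> with coefficients
      \<open>d\<close>, column by column.\<close>
    define a where "a = (\<lambda>i. if i = r then \<one> else if i \<in> A then \<ominus> d i else \<zero>)"
    have va: "a \<in> vecs (insert r A)" using d by (auto simp: a_def vecs_def)
    have "lincomb (insert r A) a M j = \<zero>" if j: "j \<in> J" for j
    proof -
      have "lincomb (insert r A) a M j = a r \<otimes> M r j \<oplus> lincomb A a M j"
        by (rule lincomb_insert) (use insert.hyps vecs_closed[OF va] M in auto)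
      also have "lincomb A a M j = (\<Oplus>s\<in>A. (\<ominus> \<one>) \<otimes> (M s j \<otimes> d s))"
        unfolding lincomb_def
      proof (rule finsum_cong')
        fix s assume s: "s \<in> A"
        have "\<ominus> d s \<otimes> M s j = (\<ominus> \<one>) \<otimes> (M s j \<otimes> d s)"
          using d[of s] is_matD[OF M, of s j] by algebra
        thus "a s \<otimes> M s j = (\<ominus> \<one>) \<otimes> (M s j \<otimes> d s)"
          using s insert.hyps by (auto simp: a_def)
      qed (use d M in auto)
      also have "\<dots> = (\<ominus> \<one>) \<otimes> (\<Oplus>s\<in>A. M s j \<otimes> d s)"
        by (rule finsum_rdistr[symmetric]) (use insert.hyps d M in auto)
      also have "\<dots> = \<ominus> (\<Oplus>s\<in>A. M s j \<otimes> d s)"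
        using finsum_closed[of "\<lambda>s. M s j \<otimes> d s" A] d M by (simp add: l_minus Pi_def)
      also have "(\<Oplus>s\<in>A. M s j \<otimes> d s) = lincomb A (\<lambda>s. M s j) (\<lambda>s. lincomb J (Z s) ?MT) r"
        by (simp add: lincomb_def[of A] d_def)
      finally show ?thesis using uM[OF j, of r] z[OF j] M by (simp add: a_def)
    qed
    hence "a \<in> left_kernel (insert r A) J M" using va by (simp add: left_kernel_def)
    hence "a r = \<zero>" by (rule lin_indep_rowsD[OF insert.prems _ M])
    thus False by (simp add: a_def)
  qed
  then obtain j0 where j0: "j0 \<in> J" and "lincomb J (u j0) ?MT r \<noteq> \<zero>" by blast
  define w where "w = lincomb J (u j0) ?MT r"
  have "w \<noteq> \<zero>" "w \<in> carrier R"
    using \<open>lincomb J (u j0) ?MT r \<noteq> \<zero>\<close> lincomb_closed[of J "u j0" ?MT r] u MT by (auto simp: w_def)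
  hence w: "w \<in> Units R" "inv w \<in> carrier R" "inv w \<otimes> w = \<one>" by (auto simp: field_Units)
  \<comment> \<open>Scaled by \<open>inv w\<close>, the vector \<open>u j0\<close> is dual to
    \<open>r\<close>. Multiples of it clear the pairing of the older columns with row
    \<open>r\<close> and leave the pairings with \<open>A\<close> untouched.\<close>
  define Z' where "Z' s = (\<lambda>j. (if s = r then \<zero> else \<one>) \<otimes> Z s j
      \<oplus> (if s = r then inv w else \<ominus> (d s \<otimes> inv w)) \<otimes> u j0 j)" for s
  have Z'M: "lincomb J (Z' s) ?MT x = (if s = r then \<zero> else \<one>) \<otimes> lincomb J (Z s) ?MT x
      \<oplus> (if s = r then inv w else \<ominus> (d s \<otimes> inv w)) \<otimes> lincomb J (u j0) ?MT x" for s x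
    unfolding Z'_def by (rule lincomb_lin) (use Z(1) u MT w d in auto)
  have cl: "lincomb J (Z s) ?MT x \<in> carrier R" for s x
    by (rule lincomb_closed) (use Z(1) MT in auto)
  have "lincomb J (Z' s) ?MT x = (if s = x then \<one> else \<zero>)"
    if s: "s \<in> insert r A" and x: "x \<in> insert r A" for s x
  proof (cases "x = r")
    case True
    show ?thesis
    proof (cases "s = r")
      case True
      thus ?thesis using \<open>x = r\<close> w cl[of r r] by (simp add: Z'M w_def[symmetric])
    next
      case False
      have "\<ominus> (d s \<otimes> inv w) \<otimes> w = \<ominus> d s"
        using w \<open>w \<in> carrier R\<close> d[of s] by (simp add: l_minus m_assoc)
      thus ?thesis using False \<open>x = r\<close> d[of s]
        by (simp add: Z'M w_def[symmetric] d_app r_neg)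
    qed
  next
    case False
    hence xA: "x \<in> A" using x by simp
    show ?thesis using uA[OF j0 xA] Z(2)[OF _ xA, of s] s False w d[of s] cl[of s x] insert.hyps
      by (auto simp: Z'M)
  qed
  moreover have "is_mat Z'" using Z(1) u w d by (auto simp: is_mat_def Z'_def)
  ultimately show ?case by (intro exI[of _ Z']) blast
qed

end

text \<open>Homomorphisms of fields are injective, so a dependency over \<open>F\<close> stays
  nontrivial over \<open>K\<close>. A dependency over \<open>K\<close> need not come from
  \<open>F\<close>; it is excluded by mapping a right inverse over \<open>F\<close> into
  \<open>K\<close>.\<close>

lemma lin_indep_rows_hom_iff:
  fixes M :: "'r \<Rightarrow> 'c \<Rightarrow> 'a"
  assumes F: "field F" and K: "field K" and h: "h \<in> ring_hom F K"
    and fin: "finite A" "finite J" and M: "\<And>r j. M r j \<in> carrier F"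
  shows "lin_indep_rows K J (\<lambda>r j. h (M r j)) A \<longleftrightarrow> lin_indep_rows F J M A"
proof
  interpret F: field F by fact
  interpret K: field K by fact
  interpret h: ring_hom_cring F K h
    by (intro ring_hom_cringI F.cring_axioms K.cring_axioms h)
  {
    assume ind: "lin_indep_rows K J (\<lambda>r j. h (M r j)) A"
    show "lin_indep_rows F J M A"
      unfolding lin_indep_rows_def
    proof (intro ballI impI)
      fix a r assume a: "a \<in> A \<rightarrow> carrier F"
        and z: "\<forall>j\<in>J. (\<Oplus>\<^bsub>F\<^esub>r\<in>A. a r \<otimes>\<^bsub>F\<^esub> M r j) = \<zero>\<^bsub>F\<^esub>" and r: "r \<in> A"
      have "(\<Oplus>\<^bsub>K\<^esub>r\<in>A. h (a r) \<otimes>\<^bsub>K\<^esub> h (M r j)) = \<zero>\<^bsub>K\<^esub>" if j: "j \<in> J" for j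
      proof -
        have "(\<Oplus>\<^bsub>K\<^esub>r\<in>A. h (a r) \<otimes>\<^bsub>K\<^esub> h (M r j)) = (\<Oplus>\<^bsub>K\<^esub>r\<in>A. h (a r \<otimes>\<^bsub>F\<^esub> M r j))"
          by (rule K.finsum_cong') (use funcset_mem[OF a] M in auto)
        also have "\<dots> = h (\<Oplus>\<^bsub>F\<^esub>r\<in>A. a r \<otimes>\<^bsub>F\<^esub> M r j)"
          using h.hom_finsum[of "\<lambda>r. a r \<otimes>\<^bsub>F\<^esub> M r j" A] a M by (simp add: comp_def Pi_def)
        finally show ?thesis using z j by simp
      qed
      moreover have "(\<lambda>r. h (a r)) \<in> A \<rightarrow> carrier K" using a by auto
      ultimately have 0: "h (a r) = \<zero>\<^bsub>K\<^esub>" using ind r unfolding lin_indep_rows_def by fastforce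
      show "a r = \<zero>\<^bsub>F\<^esub>"
      proof (rule ccontr)
        assume "a r \<noteq> \<zero>\<^bsub>F\<^esub>"
        hence "a r \<in> Units F" using a r by (auto simp: F.field_Units)
        hence "h (a r) \<otimes>\<^bsub>K\<^esub> h (inv\<^bsub>F\<^esub> a r) = \<one>\<^bsub>K\<^esub>"
          using h.hom_mult[of "a r" "inv\<^bsub>F\<^esub> a r"] F.Units_closed[of "a r"] by simp
        thus False using 0 \<open>a r \<in> Units F\<close> by simp
      qed
    qed
  next
    assume ind: "lin_indep_rows F J M A"
    have MF: "F.is_mat M" using M by (simp add: F.is_mat_def)
    obtain Z where Z: "F.is_mat Z" "\<And>s x. s \<in> A \<Longrightarrow> x \<in> A \<Longrightarrow>
        F.lincomb J (Z s) (\<lambda>j x. M x j) x = (if s = x then \<one>\<^bsub>F\<^esub> else \<zero>\<^bsub>F\<^esub>)"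
      using F.right_inverse_exists[OF fin MF ind] by blast
    have Zc: "Z s j \<in> carrier F" for s j using Z(1) by (simp add: F.is_mat_def)
    define hM where "hM = (\<lambda>r j. h (M r j))"
    have hM: "K.is_mat hM" using M by (simp add: K.is_mat_def hM_def)
    have "lin_indep_rows K J hM A"
      unfolding K.lin_indep_rows_iff[OF hM]
    proof (intro ballI allI)
      fix a s assume a: "a \<in> K.left_kernel A J hM"
      note ca = K.left_kernel_closed[OF a]
      show "a s = \<zero>\<^bsub>K\<^esub>"
      proof (cases "s \<in> A")
        case False
        thus ?thesis using a by (auto simp: K.left_kernel_def K.vecs_def)
      next
        case s: True
        \<comment> \<open>A single column of the mapped right inverse, written as a matrix with
          column type \<open>unit\<close> so that associativity applies.\<close>
        define L where "L j = (\<lambda>_::unit. h (Z s j))" for j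
        have L: "K.is_mat L" using Zc by (simp add: K.is_mat_def L_def)
        have hML: "K.lincomb J (hM r) L () = (if s = r then \<one>\<^bsub>K\<^esub> else \<zero>\<^bsub>K\<^esub>)" if r: "r \<in> A" for r
        proof -
          have "K.lincomb J (hM r) L () = (\<Oplus>\<^bsub>K\<^esub>j\<in>J. h (Z s j \<otimes>\<^bsub>F\<^esub> M r j))"
            unfolding K.lincomb_def
            by (rule K.finsum_cong') (use M Zc in \<open>auto simp: hM_def L_def K.m_comm\<close>)
          also have "\<dots> = h (F.lincomb J (Z s) (\<lambda>j x. M x j) r)"
            unfolding F.lincomb_def
            using h.hom_finsum[of "\<lambda>j. Z s j \<otimes>\<^bsub>F\<^esub> M r j" J] M Zc by (simp add: comp_def Pi_def)
          finally show ?thesis using Z(2)[OF s r] by simp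
        qed
        have "\<zero>\<^bsub>K\<^esub> = K.lincomb J (K.lincomb A a hM) L ()"
          unfolding K.lincomb_def[of J]
          by (rule K.add.finprod_one_eqI[symmetric])
            (use a L in \<open>auto simp: K.left_kernel_def intro: K.is_matD\<close>)
        also have "\<dots> = K.lincomb A a (\<lambda>r. K.lincomb J (hM r) L) ()"
          by (rule K.lincomb_lincomb) (use fin ca hM L in auto)
        also have "\<dots> = (\<Oplus>\<^bsub>K\<^esub>r\<in>A. if s = r then a r else \<zero>\<^bsub>K\<^esub>)"
          unfolding K.lincomb_def[of A]
          by (rule K.finsum_cong') (use hML ca in auto)
        also have "\<dots> = a s" by (rule K.finsum_singleton) (use s fin ca in auto)
        finally show ?thesis by simp
      qed
    qed
    thus "lin_indep_rows K J (\<lambda>r j. h (M r j)) A" by (simp add: hM_def)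
  }
qed

section \<open>The coding equations of a network\<close>

locale coded_network = finite_field R for R (structure) +
  fixes V :: "'v set" and In Out :: "'v \<Rightarrow> 'p set" and E :: "('p \<times> 'p) set" and S :: 'v
  assumes net: "adt_network V In Out E" and S: "S \<in> V"
begin

definition "Outs = (\<Union>v\<in>V. Out v)"
definition "Ins = (\<Union>v\<in>V. In v)"

lemma fin_ports: "finite V" "v \<in> V \<Longrightarrow> finite (In v)" "v \<in> V \<Longrightarrow> finite (Out v)"
  "finite Outs" "finite Ins"
  using net by (auto simp: adt_network_def Outs_def Ins_def)

lemma ports_eq: "ports V In Out = Outs \<union> Ins"
  by (auto simp: ports_def Outs_def Ins_def)

lemma port_owner:
  "v \<in> V \<Longrightarrow> w \<in> V \<Longrightarrow> e \<in> In v \<Longrightarrow> e \<notin> Out w"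
  "v \<in> V \<Longrightarrow> w \<in> V \<Longrightarrow> e \<in> In v \<Longrightarrow> e \<in> In w \<Longrightarrow> v = w"
  "v \<in> V \<Longrightarrow> w \<in> V \<Longrightarrow> e \<in> Out v \<Longrightarrow> e \<in> Out w \<Longrightarrow> v = w"
proof -
  have 1: "\<forall>v\<in>V. In v \<inter> Out v = {}" and
    2: "\<forall>v\<in>V. \<forall>w\<in>V. v \<noteq> w \<longrightarrow> (In v \<union> Out v) \<inter> (In w \<union> Out w) = {}"
    using net unfolding adt_network_def by simp_all
  show "v \<in> V \<Longrightarrow> w \<in> V \<Longrightarrow> e \<in> In v \<Longrightarrow> e \<notin> Out w" using 1 2 by (cases "v = w") blast+
  show "v \<in> V \<Longrightarrow> w \<in> V \<Longrightarrow> e \<in> In v \<Longrightarrow> e \<in> In w \<Longrightarrow> v = w" using 2 by blast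
  show "v \<in> V \<Longrightarrow> w \<in> V \<Longrightarrow> e \<in> Out v \<Longrightarrow> e \<in> Out w \<Longrightarrow> v = w" using 2 by blast
qed

lemma edge: "(e, e') \<in> E \<Longrightarrow> e \<in> Outs \<and> e' \<in> Ins"
  using net unfolding adt_network_def Outs_def Ins_def by blast

lemma Outs_Ins: "Outs \<inter> Ins = {}"
  using port_owner(1) by (auto simp: Outs_def Ins_def)

lemma fin_preds: "finite {e. (e, j) \<in> E}"
  by (rule finite_subset[OF _ fin_ports(4)]) (use edge in blast)

text \<open>Row \<open>Inl i\<close> is the source process \<open>i\<close>, row \<open>Inr e\<close> the symbol on port \<open>e\<close>; column \<open>e\<close> is
  the coding equation at port \<open>e\<close>. The coding coefficients occupy the free positions \<open>slots mu\<close>.\<close>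

definition base :: "nat + 'p \<Rightarrow> 'p \<Rightarrow> 'a" where
  "base r j = (case r of Inl i \<Rightarrow> \<zero> | Inr e \<Rightarrow> if e = j then \<ominus> \<one> else if (e, j) \<in> E then \<one> else \<zero>)"

definition slots :: "nat \<Rightarrow> ((nat + 'p) \<times> 'p) set" where
  "slots mu = {(Inl i, j) | i j. i \<in> {1..mu} \<and> j \<in> Out S} \<union>
     {(Inr e', e) | e' e. \<exists>v\<in>V. e' \<in> In v \<and> e \<in> Out v}"

definition all_rows :: "nat \<Rightarrow> (nat + 'p) set" where
  "all_rows mu = Inl ` {1..mu} \<union> Inr ` (Outs \<union> Ins)"

text \<open>The source and port symbols of a transmission form a left kernel vector on
  \<open>all_rows mu\<close>. The omitted rows are what \<open>t\<close> observes: independence of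
  the others means that no unobserved symbol can vary while the observations stay fixed.\<close>

definition rows :: "nat \<Rightarrow> 'v \<Rightarrow> (nat + 'p) set" where
  "rows mu t = Inl ` {1..mu} \<union> Inr ` (Outs \<union> Ins - In t)"

lemma base_closed: "is_mat base"
  by (auto simp: is_mat_def base_def split: sum.split)

lemma finite_slots: "finite (slots mu)"
proof (rule finite_subset)
  show "slots mu \<subseteq> all_rows mu \<times> (Outs \<union> Ins)"
    using S by (auto simp: slots_def all_rows_def Outs_def Ins_def)
  show "finite (all_rows mu \<times> (Outs \<union> Ins))" using fin_ports by (simp add: all_rows_def)
qed

lemma finite_rows: "finite (all_rows mu)" "finite (rows mu t)"
  using fin_ports by (auto simp: all_rows_def rows_def)

text \<open>The value is the defect of the coding equation at \<open>j\<close>. No free entry lies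
  in this column, since coefficients enter only the equations of output ports.\<close>

lemma lincomb_In:
  assumes a: "\<And>i. a i \<in> carrier R" and c: "is_mat c" and v: "v \<in> V" "j \<in> In v"
  shows "lincomb (all_rows mu) a (fill (slots mu) c base) j
    = \<ominus> a (Inr j) \<oplus> (\<Oplus>e\<in>{e. (e, j) \<in> E}. a (Inr e))"
proof -
  let ?F = "fill (slots mu) c base" and ?Q = "{e. (e, j) \<in> E}"
  have F: "is_mat ?F" using fill_closed[OF base_closed c] .
  have ns: "(r, j) \<notin> slots mu" for r
    using port_owner(1)[OF v(1) _ v(2)] S by (auto simp: slots_def)
  have jQ: "j \<notin> ?Q" using v edge Outs_Ins by (auto simp: Ins_def)
  have jI: "j \<in> Ins" using v by (auto simp: Ins_def)
  have "lincomb (all_rows mu) a ?F j = (\<Oplus>r\<in>insert (Inr j) (Inr ` ?Q). a r \<otimes> ?F r j)"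
    unfolding lincomb_def
  proof (rule add.finprod_mono_neutral_cong_right)
    show "insert (Inr j) (Inr ` ?Q) \<subseteq> all_rows mu" using jI edge by (auto simp: all_rows_def)
    fix r assume "r \<in> all_rows mu - insert (Inr j) (Inr ` ?Q)"
    thus "a r \<otimes> ?F r j = \<zero>" using a[of r] by (auto simp: fill_def ns base_def split: sum.split)
  qed (use finite_rows a F in auto)
  also have "\<dots> = a (Inr j) \<otimes> ?F (Inr j) j \<oplus> (\<Oplus>r\<in>Inr ` ?Q. a r \<otimes> ?F r j)"
    by (rule finsum_insert) (use fin_preds jQ a F in auto)
  also have "(\<Oplus>r\<in>Inr ` ?Q. a r \<otimes> ?F r j) = (\<Oplus>e\<in>?Q. a (Inr e) \<otimes> ?F (Inr e) j)"
    by (rule finsum_reindex) (use a F in auto)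
  also have "\<dots> = (\<Oplus>e\<in>?Q. a (Inr e))"
    by (rule finsum_cong') (use a jQ in \<open>auto simp: fill_def ns base_def\<close>)
  also have "a (Inr j) \<otimes> ?F (Inr j) j = \<ominus> a (Inr j)"
    using a[of "Inr j"] by (simp add: fill_def ns base_def r_minus)
  finally show ?thesis .
qed

lemma lincomb_Out:
  assumes a: "\<And>i. a i \<in> carrier R" and c: "is_mat c" and v: "v \<in> V" "j \<in> Out v"
  shows "lincomb (all_rows mu) a (fill (slots mu) c base) j
    = \<ominus> a (Inr j) \<oplus> ((\<Oplus>e'\<in>In v. c (Inr e') j \<otimes> a (Inr e'))
      \<oplus> (if v = S then \<Oplus>i\<in>{1..mu}. c (Inl i) j \<otimes> a (Inl i) else \<zero>))"
proof -
  let ?F = "fill (slots mu) c base"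
  define B :: "(nat + 'p) set" where "B = (if v = S then Inl ` {1..mu} else {})"
  have B: "finite B" "B \<subseteq> all_rows mu" "Inr e \<notin> B" "Inl i \<in> B \<longleftrightarrow> v = S \<and> i \<in> {1..mu}" for i e
    by (auto simp: B_def all_rows_def)
  have F: "is_mat ?F" using fill_closed[OF base_closed c] .
  have jn: "j \<notin> Ins" using v Outs_Ins by (auto simp: Outs_def)
  hence nE: "(e, j) \<notin> E" for e using edge by blast
  have jO: "j \<in> Outs" using v by (auto simp: Outs_def)
  have jI: "j \<notin> In v" using jn v by (auto simp: Ins_def)
  have slR: "(Inr e, j) \<in> slots mu \<longleftrightarrow> e \<in> In v" for e
  proof -
    have "w = v" if "w \<in> V" "j \<in> Out w" for w using port_owner(3)[OF that(1) v(1) that(2) v(2)] .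
    thus ?thesis using v unfolding slots_def by blast
  qed
  have slL: "(Inl i, j) \<in> slots mu \<longleftrightarrow> i \<in> {1..mu} \<and> v = S" for i
  proof -
    have "j \<in> Out S \<longleftrightarrow> v = S" using port_owner(3)[OF v(1) S v(2)] v by blast
    thus ?thesis unfolding slots_def by blast
  qed
  have fI: "finite (In v)" using fin_ports v by simp
  have "lincomb (all_rows mu) a ?F j = (\<Oplus>r\<in>insert (Inr j) (Inr ` In v \<union> B). a r \<otimes> ?F r j)"
    unfolding lincomb_def
  proof (rule add.finprod_mono_neutral_cong_right)
    show "insert (Inr j) (Inr ` In v \<union> B) \<subseteq> all_rows mu"
      using jO v B(2) by (auto simp: all_rows_def Ins_def)
    fix r assume "r \<in> all_rows mu - insert (Inr j) (Inr ` In v \<union> B)"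
    thus "a r \<otimes> ?F r j = \<zero>"
      using a[of r] by (cases r) (auto simp: fill_def slR slL base_def nE B)
  qed (use finite_rows a F in auto)
  also have "\<dots> = a (Inr j) \<otimes> ?F (Inr j) j \<oplus> (\<Oplus>r\<in>Inr ` In v \<union> B. a r \<otimes> ?F r j)"
    by (rule finsum_insert) (use fI jI B a is_matD[OF F] in auto)
  also have "(\<Oplus>r\<in>Inr ` In v \<union> B. a r \<otimes> ?F r j)
      = (\<Oplus>r\<in>Inr ` In v. a r \<otimes> ?F r j) \<oplus> (\<Oplus>r\<in>B. a r \<otimes> ?F r j)"
    by (rule finsum_Un_disjoint) (use fI B a is_matD[OF F] in auto)
  also have "(\<Oplus>r\<in>Inr ` In v. a r \<otimes> ?F r j) = (\<Oplus>e\<in>In v. a (Inr e) \<otimes> ?F (Inr e) j)"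
    by (rule finsum_reindex) (use a F in auto)
  also have "\<dots> = (\<Oplus>e'\<in>In v. c (Inr e') j \<otimes> a (Inr e'))"
    by (rule finsum_cong') (use a c in \<open>auto simp: fill_def slR m_comm\<close>)
  also have "(\<Oplus>r\<in>B. a r \<otimes> ?F r j) = (if v = S then \<Oplus>i\<in>{1..mu}. c (Inl i) j \<otimes> a (Inl i) else \<zero>)"
  proof (cases "v = S")
    case True
    have "(\<Oplus>r\<in>Inl ` {1..mu}. a r \<otimes> ?F r j) = (\<Oplus>i\<in>{1..mu}. a (Inl i) \<otimes> ?F (Inl i) j)"
      by (rule finsum_reindex) (use a F in auto)
    also have "\<dots> = (\<Oplus>i\<in>{1..mu}. c (Inl i) j \<otimes> a (Inl i))"
      by (rule finsum_cong') (use a c True in \<open>auto simp: fill_def slL m_comm\<close>)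
    finally show ?thesis using True by (simp add: B_def)
  qed (simp add: B_def)
  also have "a (Inr j) \<otimes> ?F (Inr j) j = \<ominus> a (Inr j)"
    using a[of "Inr j"] jI by (simp add: fill_def slR base_def r_minus)
  finally show ?thesis .
qed

text \<open>A free entry in a port row joins an input port to an output port, so it lies neither on
  the diagonal nor on an edge. Hence \<open>base\<close> is the coding matrix with all coefficients
  zero, and its defects are special cases of those computed above.\<close>

lemma fill_zero: "fill (slots mu) (\<lambda>_ _. \<zero>) base = base"
proof -
  have "base r j = \<zero>" if sl: "(r, j) \<in> slots mu" for r j
  proof (cases r)
    case (Inr e)
    then obtain v where v: "v \<in> V" "e \<in> In v" "j \<in> Out v" using sl by (auto simp: slots_def)
    hence "e \<noteq> j" "(e, j) \<notin> E" using port_owner(1) edge Outs_Ins by (auto simp: Outs_def Ins_def)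
    thus ?thesis using Inr by (simp add: base_def)
  qed (simp add: base_def)
  thus ?thesis by (auto simp: fill_def fun_eq_iff)
qed

lemma lincomb_base:
  assumes a: "a \<in> vecs I" and I: "I \<subseteq> all_rows mu"
  shows "j \<in> Outs \<Longrightarrow> lincomb I a base j = \<ominus> a (Inr j)"
    and "j \<in> Ins \<Longrightarrow> lincomb I a base j = \<ominus> a (Inr j) \<oplus> (\<Oplus>e\<in>{e. (e, j) \<in> E}. a (Inr e))"
proof -
  note ca = vecs_closed[OF a]
  have z: "is_mat (\<lambda>_ _. \<zero>)" by (simp add: is_mat_def)
  have eq: "lincomb I a base j = lincomb (all_rows mu) a (fill (slots mu) (\<lambda>_ _. \<zero>) base) j" for j
    unfolding fill_zero
    by (rule lincomb_neutral[symmetric]) (use a I finite_rows ca base_closed in \<open>auto simp: vecs_def\<close>)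
  show "lincomb I a base j = \<ominus> a (Inr j)" if "j \<in> Outs"
  proof -
    from that obtain v where v: "v \<in> V" "j \<in> Out v" by (auto simp: Outs_def)
    have 1: "(\<Oplus>e'\<in>In v. \<zero> \<otimes> a (Inr e')) = \<zero>" by (rule add.finprod_one_eqI) (simp add: ca)
    have 2: "(\<Oplus>i\<in>{1..mu}. \<zero> \<otimes> a (Inl i)) = \<zero>" by (rule add.finprod_one_eqI) (simp add: ca)
    show ?thesis unfolding eq lincomb_Out[OF ca z v] 1 2 by (simp add: ca)
  qed
  show "lincomb I a base j = \<ominus> a (Inr j) \<oplus> (\<Oplus>e\<in>{e. (e, j) \<in> E}. a (Inr e))" if "j \<in> Ins"
    using that unfolding eq by (auto simp: Ins_def intro: lincomb_In[OF ca z])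
qed

text \<open>An obstruction is refuted by counting. Source part and defects outside \<open>J\<close>
  always determine a kernel vector, but this bound on the kernel exceeds the required one by
  \<open>card B \<le> mu\<close> in the exponent. The rank of one cut pays for the source
  part.\<close>

lemma unicast_fill:
  assumes cut: "\<And>\<Omega>. \<Omega> \<subseteq> V \<Longrightarrow> S \<in> \<Omega> \<Longrightarrow> t \<notin> \<Omega> \<Longrightarrow>
      \<exists>A \<subseteq> \<Union>v\<in>\<Omega>. Out v. mu \<le> card A \<and> lin_indep_rows R (\<Union>w\<in>V - \<Omega>. In w) (cut_matrix R E) A"
    and tS: "t \<noteq> S"
  shows "\<exists>c. is_mat c \<and> lin_indep_rows R (ports V In Out) (fill (slots mu) c base) (rows mu t)"
proof (rule ccontr)
  assume "\<not> ?thesis"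
  then obtain I J where IJ: "I \<subseteq> rows mu t" "J \<subseteq> Outs \<union> Ins" "(I \<times> J) \<inter> slots mu = {}"
      and big: "card (left_kernel I J base) > q ^ card (Outs \<union> Ins - J)"
    using fill_obstruction[OF finite_slots finite_rows(2) _ base_closed, of "Outs \<union> Ins" mu mu t] fin_ports
    unfolding ports_eq by auto
  have Iall: "I \<subseteq> all_rows mu" using IJ(1) by (auto simp: rows_def all_rows_def)
  have finI: "finite I" using IJ(1) finite_rows finite_subset by blast
  note lb = lincomb_base[OF _ Iall]
  define B where "B = {i. Inl i \<in> I}"
  have B: "B \<subseteq> {1..mu}" using IJ(1) by (auto simp: B_def rows_def)
  have finX: "finite B" using B finite_subset by blast
  \<comment> \<open>\<open>A\<close> consists of output ports whose symbols are forced by the input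
    equations, so that their defects need not be recorded. Without source rows in \<open>I\<close>
    nothing has to be saved; with one, \<open>S\<close> falls on the source side of the cut.\<close>
  have "\<exists>A \<subseteq> Outs - J. card B \<le> card A \<and>
      (\<forall>b\<in>vecs I. (\<forall>e\<in>Outs - A. b (Inr e) = \<zero>) \<longrightarrow> (\<forall>e\<in>Ins. lincomb I b base e = \<zero>) \<longrightarrow> (\<forall>e\<in>A. b (Inr e) = \<zero>))"
  proof (cases "B = {}")
    case True
    thus ?thesis by (intro exI[of _ "{}"]) simp
  next
    case False
    then obtain i where i: "Inl i \<in> I" by (auto simp: B_def)
    \<comment> \<open>A source row in \<open>I\<close> keeps the outputs of \<open>S\<close> out of
      \<open>J\<close>. A node outside \<open>\<Omega>\<close> other than \<open>t\<close> has an
      output in \<open>J\<close>, which keeps its inputs out of \<open>I\<close>; the inputs of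
      \<open>t\<close> are absent from \<open>rows mu t\<close> already, so \<open>t\<close> may be
      moved to the sink side.\<close>
    define \<Omega> where "\<Omega> = {v \<in> V. J \<inter> Out v = {}} - {t}"
    have "i \<in> {1..mu}" using i B by (auto simp: B_def)
    hence "S \<in> \<Omega>" using S tS IJ(3) i by (auto simp: \<Omega>_def slots_def)
    then obtain A where A: "A \<subseteq> (\<Union>v\<in>\<Omega>. Out v)" "mu \<le> card A"
        "lin_indep_rows R (\<Union>w\<in>V - \<Omega>. In w) (cut_matrix R E) A"
      using cut[of \<Omega>] by (auto simp: \<Omega>_def)
    have AO: "A \<subseteq> Outs - J" using A(1) by (fastforce simp: \<Omega>_def Outs_def)
    have finA: "finite A" using AO fin_ports(4) by (meson Diff_subset finite_subset subset_trans)
    have "card B \<le> card A" using A(2) card_mono[OF _ B] by simp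
    moreover have "b (Inr e) = \<zero>"
      if b: "b \<in> vecs I" and z: "\<forall>e\<in>Outs - A. b (Inr e) = \<zero>" "\<forall>e\<in>Ins. lincomb I b base e = \<zero>"
        and e: "e \<in> A" for b e
    proof -
      note cb = vecs_closed[OF b]
      have "(\<Oplus>e\<in>A. b (Inr e) \<otimes> cut_matrix R E e j) = \<zero>" if j: "j \<in> In w" "w \<in> V - \<Omega>" for j w
      proof -
        have "Inr j \<notin> I"
        proof (cases "w = t")
          case True
          thus ?thesis using IJ(1) j by (auto simp: rows_def)
        next
          case False
          then obtain e where "e \<in> J" "e \<in> Out w" using j by (auto simp: \<Omega>_def)
          thus ?thesis using IJ(3) j by (auto simp: slots_def)
        qed
        hence "b (Inr j) = \<zero>" using b by (auto simp: vecs_def)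
        moreover have jI: "j \<in> Ins" using j by (auto simp: Ins_def)
        \<comment> \<open>As \<open>j\<close> itself carries zero, its equation says that the
          symbols entering \<open>j\<close> sum to zero. They are supported on \<open>A\<close>, so
          this is a relation between rows of the cut matrix.\<close>
        ultimately have "(\<Oplus>e\<in>{e. (e, j) \<in> E}. b (Inr e)) = \<zero>"
          using lb(2)[OF b jI] z(2) finsum_closed[of "\<lambda>e. b (Inr e)" "{e. (e, j) \<in> E}"] cb by simp
        moreover have "(\<Oplus>e\<in>{e. (e, j) \<in> E}. b (Inr e)) = (\<Oplus>e\<in>A. b (Inr e) \<otimes> cut_matrix R E e j)"
          by (rule add.finprod_mono_neutral_cong)
            (use cb fin_preds finA edge z(1) in \<open>auto simp: cut_matrix_def\<close>)
        ultimately show ?thesis by simp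
      qed
      thus ?thesis using A(3) e cb unfolding lin_indep_rows_def by (auto dest!: bspec[of _ _ "\<lambda>e. b (Inr e)"])
    qed
    ultimately show ?thesis using AO by blast
  qed
  then obtain A where A: "A \<subseteq> Outs - J" "card B \<le> card A"
    and key: "\<And>b. b \<in> vecs I \<Longrightarrow> (\<forall>e\<in>Outs - A. b (Inr e) = \<zero>) \<Longrightarrow>
      (\<forall>e\<in>Ins. lincomb I b base e = \<zero>) \<Longrightarrow> (\<forall>e\<in>A. b (Inr e) = \<zero>)" by blast
  \<comment> \<open>A left-kernel vector is determined by its source part and its residuals in the columns
    outside \<open>J \<union> A\<close>: the rows \<open>A\<close>, independent across the cut, save \<open>card A\<close> parameters.\<close>
  define D where "D = Inl ` B \<union> Inr ` (Outs \<union> Ins - J - A)"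
  define \<phi> where "\<phi> a = restrict (\<lambda>d. case d of Inl i \<Rightarrow> a (Inl i) | Inr e \<Rightarrow> lincomb I a base e) D" for a
  have finA: "finite A" using A(1) fin_ports finite_subset by blast
  have finD: "finite D" using finX fin_ports by (simp add: D_def)
  have "inj_on \<phi> (left_kernel I J base)"
  proof (rule inj_onI)
    fix a a' assume a: "a \<in> left_kernel I J base" and a': "a' \<in> left_kernel I J base" and e: "\<phi> a = \<phi> a'"
    note ca = left_kernel_closed[OF a] and ca' = left_kernel_closed[OF a']
    define b where "b = (\<lambda>i. \<one> \<otimes> a i \<oplus> (\<ominus> \<one>) \<otimes> a' i)"
    have bk: "b \<in> left_kernel I J base"
      unfolding b_def by (rule left_kernel_lin) (use a a' base_closed in auto)
    hence b: "b \<in> vecs I" by (simp add: left_kernel_def)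
    have lbb: "lincomb I b base j = \<one> \<otimes> lincomb I a base j \<oplus> (\<ominus> \<one>) \<otimes> lincomb I a' base j" for j
      unfolding b_def by (rule lincomb_lin) (use ca ca' base_closed in auto)
    have lcl: "lincomb I a' base j \<in> carrier R" for j
      by (rule lincomb_closed) (use ca' base_closed in auto)
    have z: "lincomb I b base j = \<zero>" if j: "j \<in> Outs \<union> Ins - A" for j
    proof (cases "j \<in> J")
      case True
      thus ?thesis using bk by (simp add: left_kernel_def)
    next
      case False
      hence "lincomb I a base j = lincomb I a' base j"
        using fun_cong[OF e, of "Inr j"] j by (simp add: \<phi>_def D_def)
      thus ?thesis using lbb lcl by (simp add: l_minus r_neg)
    qed
    note cb = vecs_closed[OF b]
    have "b (Inr j) = \<zero>" if "j \<in> Outs - A" for j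
      using z[of j] lb(1)[OF b, of j] that cb by simp
    moreover have zI: "\<forall>j\<in>Ins. lincomb I b base j = \<zero>" using z A(1) Outs_Ins by auto
    ultimately have bO: "b (Inr j) = \<zero>" if "j \<in> Outs" for j using key[OF b] that by blast
    have bI: "b (Inr j) = \<zero>" if j: "j \<in> Ins" for j
    proof -
      have "(\<Oplus>e\<in>{e. (e, j) \<in> E}. b (Inr e)) = \<zero>"
        by (rule add.finprod_one_eqI) (use edge bO in auto)
      hence "\<ominus> b (Inr j) = \<zero>" using lb(2)[OF b j] bspec[OF zI j] cb[of "Inr j"] by simp
      thus ?thesis using cb[of "Inr j"] by (metis minus_minus minus_zero)
    qed
    have bX: "b (Inl i) = \<zero>" for i
    proof (cases "i \<in> B")
      case True
      hence "a (Inl i) = a' (Inl i)"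
        using fun_cong[OF e, of "Inl i"] by (simp add: \<phi>_def D_def)
      thus ?thesis using ca' by (simp add: b_def l_minus r_neg)
    qed (use b in \<open>auto simp: B_def vecs_def\<close>)
    have b0: "b r = \<zero>" for r
    proof (cases "r \<in> I")
      case True
      thus ?thesis using Iall bO bI bX by (auto simp: all_rows_def)
    qed (use b in \<open>auto simp: vecs_def\<close>)
    show "a = a'"
    proof
      fix r
      have "a r \<oplus> \<ominus> a' r = \<zero>" using b0[of r] ca[of r] ca'[of r] by (simp add: b_def l_minus)
      thus "a r = a' r" using ca[of r] ca'[of r] by (metis minus_equality minus_minus add.inv_closed)
    qed
  qed
  moreover have "\<phi> ` left_kernel I J base \<subseteq> PiE D (\<lambda>_. carrier R)"
  proof -
    have "lincomb I a base j \<in> carrier R" if "a \<in> left_kernel I J base" for a j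
      by (rule lincomb_closed) (use left_kernel_closed[OF that] base_closed in auto)
    thus ?thesis by (auto simp: \<phi>_def left_kernel_closed split: sum.split)
  qed
  moreover have "finite (PiE D (\<lambda>_. carrier R))" using finD finite_carrier by (simp add: finite_PiE)
  ultimately have "card (left_kernel I J base) \<le> card (PiE D (\<lambda>_. carrier R))" by (rule card_inj_on_le)
  also have "\<dots> = q ^ card D" using finD by (simp add: card_PiE q_def)
  also have "card D = card B + card (Outs \<union> Ins - J - A)"
    unfolding D_def by (subst card_Un_disjoint) (use finX fin_ports in \<open>auto simp: card_image\<close>)
  also have "card (Outs \<union> Ins - J - A) = card (Outs \<union> Ins - J) - card A"
    by (rule card_Diff_subset) (use finA A(1) in auto)
  finally have "card (left_kernel I J base) \<le> q ^ (card B + (card (Outs \<union> Ins - J) - card A))" .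
  also have "card A \<le> card (Outs \<union> Ins - J)" by (rule card_mono) (use A fin_ports in auto)
  hence "q ^ (card B + (card (Outs \<union> Ins - J) - card A)) \<le> q ^ card (Outs \<union> Ins - J)"
    using A(2) q_gt_1 by (intro power_increasing) auto
  finally show False using big by simp
qed

text \<open>The coding equations say that the vector of all symbols annihilates the matrix.
  Multiplying by the column of a right inverse dual to source row \<open>k\<close> eliminates every
  symbol except \<open>x k\<close> and those on the input ports of \<open>t\<close>.\<close>

lemma decoder_exists:
  assumes c: "is_mat c" and t: "t \<in> V"
    and ind: "lin_indep_rows R (ports V In Out) (fill (slots mu) c base) (rows mu t)"
  shows "\<exists>\<epsilon>. (\<forall>e' k. \<epsilon> e' k \<in> carrier R) \<and> (\<forall>x\<in>{1..mu} \<rightarrow> carrier R. \<forall>Y.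
    coding_equations R V In Out E S mu (\<lambda>i. c (Inl i)) (\<lambda>e'. c (Inr e')) x Y \<longrightarrow>
      (\<forall>k\<in>{1..mu}. (\<Oplus>e'\<in>In t. \<epsilon> e' k \<otimes> Y e') = x k))"
proof -
  let ?F = "fill (slots mu) c base"
  let ?P = "Outs \<union> Ins"
  have F: "is_mat ?F" using fill_closed[OF base_closed c] .
  have FT: "is_mat (\<lambda>j r. ?F r j)" using F by (simp add: is_mat_def)
  have finP: "finite ?P" using fin_ports by simp
  obtain Z where Z: "is_mat Z" "\<And>s r. s \<in> rows mu t \<Longrightarrow> r \<in> rows mu t \<Longrightarrow>
      lincomb ?P (Z s) (\<lambda>j r. ?F r j) r = (if s = r then \<one> else \<zero>)"
    using right_inverse_exists[OF finite_rows(2) finP F] ind unfolding ports_eq by blast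
  \<comment> \<open>For a source index \<open>k\<close> this is the unit vector at
    \<open>Inl k\<close> on \<open>rows mu t\<close>. On the input ports of \<open>t\<close> it is
    unconstrained, and its negatives there are the decoding coefficients.\<close>
  define g where "g k r = lincomb ?P (Z (Inl k)) (\<lambda>j r. ?F r j) r" for k r
  have g: "g k r \<in> carrier R" for k r
    unfolding g_def by (rule lincomb_closed) (use Z(1) FT in auto)
  define \<epsilon> where "\<epsilon> e' k = \<ominus> g k (Inr e')" for e' k
  show ?thesis
  proof (intro exI[of _ \<epsilon>] conjI allI ballI impI)
    show "\<epsilon> e' k \<in> carrier R" for e' k using g by (simp add: \<epsilon>_def)
    fix x Y k
    assume x: "x \<in> {1..mu} \<rightarrow> carrier R" and k: "k \<in> {1..mu}"
      and ce: "coding_equations R V In Out E S mu (\<lambda>i. c (Inl i)) (\<lambda>e'. c (Inr e')) x Y"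
    have Yc: "Y e \<in> carrier R" if "e \<in> ?P" for e
      using ce that by (simp add: coding_equations_def ports_eq)
    have YT: "Y e \<in> carrier R" if "e \<in> In t" for e
      using Yc[of e] that t by (auto simp: Ins_def)
    define z where "z r = (case r of Inl i \<Rightarrow> if i \<in> {1..mu} then x i else \<zero>
      | Inr e \<Rightarrow> if e \<in> ?P then Y e else \<zero>)" for r
    have z: "z r \<in> carrier R" for r using x Yc by (auto simp: z_def split: sum.split)
    have res: "lincomb (all_rows mu) z ?F j = \<zero>" if j: "j \<in> ?P" for j
    proof -
      have zj: "z (Inr j) = Y j" using j by (simp add: z_def)
      consider v where "v \<in> V" "j \<in> Out v" | v where "v \<in> V" "j \<in> In v"
        using j by (auto simp: Outs_def Ins_def)
      thus ?thesis
      proof cases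
        case v: 1
        have YI: "Y e \<in> carrier R" if "e \<in> In v" for e
          using Yc[of e] that v by (auto simp: Ins_def)
        have 1: "(\<Oplus>e'\<in>In v. c (Inr e') j \<otimes> z (Inr e')) = (\<Oplus>e'\<in>In v. c (Inr e') j \<otimes> Y e')"
          by (rule finsum_cong') (use v YI c in \<open>auto simp: z_def Ins_def\<close>)
        have 2: "(\<Oplus>i\<in>{1..mu}. c (Inl i) j \<otimes> z (Inl i)) = (\<Oplus>i\<in>{1..mu}. c (Inl i) j \<otimes> x i)"
          by (rule finsum_cong') (use x c in \<open>auto simp: z_def\<close>)
        have 3: "Y j = (\<Oplus>e'\<in>In v. c (Inr e') j \<otimes> Y e')
            \<oplus> (if v = S then \<Oplus>i\<in>{1..mu}. c (Inl i) j \<otimes> x i else \<zero>)"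
          using ce v by (simp add: coding_equations_def)
        show ?thesis
          using l_neg[OF Yc[OF j]] by (simp only: lincomb_Out[where a = z, OF z c v] zj 1 2 3[symmetric])
      next
        case v: 2
        have 1: "(\<Oplus>e\<in>{e. (e, j) \<in> E}. z (Inr e)) = (\<Oplus>e\<in>{e. (e, j) \<in> E}. Y e)"
          by (rule finsum_cong') (use edge Yc in \<open>auto simp: z_def\<close>)
        have 2: "Y j = (\<Oplus>e\<in>{e. (e, j) \<in> E}. Y e)"
          using ce v by (simp add: coding_equations_def)
        show ?thesis
          unfolding lincomb_In[where a = z, OF z c v] zj 1 2[symmetric] by (rule l_neg) (rule Yc[OF j])
      qed
    qed
    define L where "L j = (\<lambda>_::unit. Z (Inl k) j)" for j
    have L: "is_mat L" using Z(1) by (simp add: L_def is_mat_def)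
    have gL: "lincomb ?P (?F r) L () = g k r" for r
      unfolding g_def lincomb_def
      by (rule finsum_cong') (use Z(1) F in \<open>auto simp: L_def m_comm\<close>)
    have "\<zero> = lincomb ?P (lincomb (all_rows mu) z ?F) L ()"
      unfolding lincomb_def[of ?P]
      by (rule add.finprod_one_eqI[symmetric]) (use res L in simp)
    also have "\<dots> = lincomb (all_rows mu) z (\<lambda>r. lincomb ?P (?F r) L) ()"
      by (rule lincomb_lincomb) (use finite_rows finP z F L in auto)
    also have "\<dots> = (\<Oplus>r\<in>rows mu t \<union> Inr ` In t. z r \<otimes> g k r)"
    proof -
      have "all_rows mu = rows mu t \<union> Inr ` In t"
        using t by (auto simp: all_rows_def rows_def Ins_def)
      thus ?thesis by (simp add: lincomb_def[of "all_rows mu"] lincomb_def[of "rows mu t \<union> Inr ` In t"] gL)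
    qed
    also have "\<dots> = (\<Oplus>r\<in>rows mu t. z r \<otimes> g k r) \<oplus> (\<Oplus>r\<in>Inr ` In t. z r \<otimes> g k r)"
      by (rule finsum_Un_disjoint) (use finite_rows fin_ports t z g in \<open>auto simp: rows_def\<close>)
    also have "(\<Oplus>r\<in>rows mu t. z r \<otimes> g k r) = x k"
    proof -
      have kr: "Inl k \<in> rows mu t" using k by (simp add: rows_def)
      have "(\<Oplus>r\<in>rows mu t. z r \<otimes> g k r) = (\<Oplus>r\<in>rows mu t. if Inl k = r then z r else \<zero>)"
        by (rule finsum_cong') (use z Z(2)[OF kr] in \<open>auto simp: g_def\<close>)
      also have "\<dots> = z (Inl k)" by (rule finsum_singleton) (use kr finite_rows z in auto)
      finally show ?thesis using k by (simp add: z_def)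
    qed
    also have "(\<Oplus>r\<in>Inr ` In t. z r \<otimes> g k r) = (\<Oplus>e\<in>In t. z (Inr e) \<otimes> g k (Inr e))"
      by (rule finsum_reindex) (use z g in auto)
    also have "\<dots> = (\<Oplus>e\<in>In t. (\<ominus> \<one>) \<otimes> (\<epsilon> e k \<otimes> Y e))"
    proof (rule finsum_cong')
      fix e assume "e \<in> In t"
      hence "z (Inr e) = Y e" "Y e \<in> carrier R" using t YT Yc by (auto simp: z_def Ins_def)
      thus "z (Inr e) \<otimes> g k (Inr e) = (\<ominus> \<one>) \<otimes> (\<epsilon> e k \<otimes> Y e)"
        using g[of k "Inr e"] unfolding \<epsilon>_def by (simp, algebra)
    qed (use t YT g in \<open>auto simp: Ins_def \<epsilon>_def\<close>)
    also have "\<dots> = (\<ominus> \<one>) \<otimes> (\<Oplus>e\<in>In t. \<epsilon> e k \<otimes> Y e)"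
      by (rule finsum_rdistr[symmetric]) (use t YT g fin_ports in \<open>auto simp: Ins_def \<epsilon>_def\<close>)
    finally have eq: "x k \<oplus> (\<ominus> \<one>) \<otimes> (\<Oplus>e\<in>In t. \<epsilon> e k \<otimes> Y e) = \<zero>" by simp
    have "x k \<in> carrier R" "(\<Oplus>e\<in>In t. \<epsilon> e k \<otimes> Y e) \<in> carrier R"
      using x k t YT g by (auto simp: Ins_def \<epsilon>_def intro!: finsum_closed)
    thus "(\<Oplus>e\<in>In t. \<epsilon> e k \<otimes> Y e) = x k"
      using eq by (simp add: l_minus) (metis a_minus_def r_right_minus_eq)
  qed
qed

lemma multicast_solvable:
  assumes T: "\<And>n. n \<in> {1..N} \<Longrightarrow> T n \<in> V \<and> T n \<noteq> S" and N: "N < q"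
    and cut: "\<And>n \<Omega>. n \<in> {1..N} \<Longrightarrow> \<Omega> \<subseteq> V \<Longrightarrow> S \<in> \<Omega> \<Longrightarrow> T n \<notin> \<Omega> \<Longrightarrow>
      \<exists>A \<subseteq> \<Union>v\<in>\<Omega>. Out v. mu \<le> card A \<and> lin_indep_rows R (\<Union>w\<in>V - \<Omega>. In w) (cut_matrix R E) A"
  shows "linearly_solvable R V In Out E S mu T N"
proof -
  have "\<exists>c. is_mat c \<and> (\<forall>n\<in>{1..N}. lin_indep_rows R (ports V In Out) (fill (slots mu) c base) (rows mu (T n)))"
    by (rule common_fill) (use finite_slots finite_rows base_closed N unicast_fill cut T in auto)
  then obtain c where c: "is_mat c"
      "\<And>n. n \<in> {1..N} \<Longrightarrow> lin_indep_rows R (ports V In Out) (fill (slots mu) c base) (rows mu (T n))"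
    by blast
  define dec where "dec t \<epsilon> \<longleftrightarrow> (\<forall>x\<in>{1..mu} \<rightarrow> carrier R. \<forall>Y.
    coding_equations R V In Out E S mu (\<lambda>i. c (Inl i)) (\<lambda>e'. c (Inr e')) x Y \<longrightarrow>
      (\<forall>k\<in>{1..mu}. (\<Oplus>e'\<in>In t. \<epsilon> e' k \<otimes> Y e') = x k))" for t \<epsilon>
  \<comment> \<open>Decoding coefficients are indexed by nodes, and several indices may name the
    same sink; they are therefore chosen per node, with zeros where no sink is.\<close>
  have "\<forall>t. \<exists>\<epsilon>. (\<forall>e' k. \<epsilon> e' k \<in> carrier R) \<and> (t \<in> T ` {1..N} \<longrightarrow> dec t \<epsilon>)"
  proof
    fix t
    show "\<exists>\<epsilon>. (\<forall>e' k. \<epsilon> e' k \<in> carrier R) \<and> (t \<in> T ` {1..N} \<longrightarrow> dec t \<epsilon>)"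
    proof (cases "t \<in> T ` {1..N}")
      case True
      then obtain n where n: "n \<in> {1..N}" "t = T n" by blast
      show ?thesis
        using decoder_exists[OF c(1) _ c(2)[OF n(1)]] T[OF n(1)] unfolding n(2) dec_def by blast
    next
      case False
      thus ?thesis by (intro exI[of _ "\<lambda>_ _. \<zero>"]) simp
    qed
  qed
  then obtain \<epsilon> where "\<forall>t. (\<forall>e' k. \<epsilon> t e' k \<in> carrier R) \<and> (t \<in> T ` {1..N} \<longrightarrow> dec t (\<epsilon> t))"
    by (rule choice[THEN exE])
  hence eps: "\<And>t e' k. \<epsilon> t e' k \<in> carrier R" "\<And>n. n \<in> {1..N} \<Longrightarrow> dec (T n) (\<epsilon> (T n))" by blast+
  show ?thesis
    unfolding linearly_solvable_def
    by (rule exI[of _ "\<lambda>i. c (Inl i)"], rule exI[of _ "\<lambda>e'. c (Inr e')"], rule exI[of _ \<epsilon>])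
      (use c(1) eps in \<open>auto simp: dec_def\<close>)
qed

end

section \<open>Symbols crossing a cut, and necessity of the cut condition\<close>

context coded_network
begin

lemma wf_node_rel: "wf (node_rel V In Out E)"
proof (rule finite_acyclic_wf)
  show "finite (node_rel V In Out E)"
    by (rule finite_subset[of _ "V \<times> V"]) (use fin_ports in \<open>auto simp: node_rel_def\<close>)
  show "acyclic (node_rel V In Out E)" using net by (simp add: adt_network_def)
qed

text \<open>\<open>linearly_solvable\<close> speaks of all solutions \<open>Y\<close>, so it
  constrains nothing for a message that has none. Acyclicity provides a solution by recursion over
  the supernodes.\<close>

lemma coding_solution_exists:
  assumes \<alpha>: "\<And>i e. \<alpha> i e \<in> carrier R" and \<beta>: "\<And>e' e. \<beta> e' e \<in> carrier R"
    and x: "x \<in> {1..mu} \<rightarrow> carrier R"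
  shows "\<exists>Y. coding_equations R V In Out E S mu \<alpha> \<beta> x Y"
proof -
  define own where "own e = (THE v. v \<in> V \<and> e \<in> Out v)" for e
  have own: "own e = v" if "v \<in> V" "e \<in> Out v" for e v
    unfolding own_def by (rule the_equality) (use that port_owner(3) in auto)
  define NR where "NR = node_rel V In Out E"
  \<comment> \<open>The guard restricts the recursion to predecessors of \<open>v\<close>, as
    \<open>adm_wf\<close> demands; it holds for every edge into an input port of \<open>v\<close>,
    so it disappears in \<open>YG\<close>.\<close>
  define G where "G f v e' = (\<Oplus>u\<in>{u. (u, e') \<in> E}. if (own u, v) \<in> NR then f (own u) u else \<zero>)"
    for f :: "'v \<Rightarrow> 'p \<Rightarrow> 'a" and v e'
  define H where "H f v = (\<lambda>e. (\<Oplus>e'\<in>In v. \<beta> e' e \<otimes> G f v e')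
    \<oplus> (if v = S then \<Oplus>i\<in>{1..mu}. \<alpha> i e \<otimes> x i else \<zero>))" for f :: "'v \<Rightarrow> 'p \<Rightarrow> 'a" and v
  define f where "f = wfrec NR H"
  have wf: "wf NR" unfolding NR_def by (rule wf_node_rel)
  have "adm_wf NR H"
    unfolding adm_wf_def
  proof (intro allI impI)
    fix f g :: "'v \<Rightarrow> 'p \<Rightarrow> 'a" and v
    assume fg: "\<forall>z. (z, v) \<in> NR \<longrightarrow> f z = g z"
    have "(if (own u, v) \<in> NR then f (own u) u else \<zero>) = (if (own u, v) \<in> NR then g (own u) u else \<zero>)" for u
      using fg by simp
    hence "G f v = G g v" by (simp only: G_def fun_eq_iff simp_thms)
    thus "H f v = H g v" by (simp add: H_def)
  qed
  hence fH: "f v = H f v" for v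
    using wfrec_fixpoint[OF wf] unfolding f_def by metis
  have xs: "(\<Oplus>i\<in>{1..mu}. \<alpha> i e \<otimes> x i) \<in> carrier R" for e
    by (rule finsum_closed) (use \<alpha> x in auto)
  have f_closed: "\<forall>e. f v e \<in> carrier R" for v
  proof (induction v rule: wf_induct_rule[OF wf])
    case (1 v)
    have "G f v e' \<in> carrier R" for e'
      unfolding G_def by (rule finsum_closed) (use 1 in auto)
    hence "(\<Oplus>e'\<in>In v. \<beta> e' e \<otimes> G f v e') \<in> carrier R" for e
      by (intro finsum_closed) (use \<beta> in auto)
    thus ?case using xs by (subst fH) (auto simp: H_def)
  qed
  define Y where "Y e = (if e \<in> Outs then f (own e) e else \<Oplus>u\<in>{u. (u, e) \<in> E}. f (own u) u)" for e
  have Yc: "Y e \<in> carrier R" for e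
    using f_closed by (auto simp: Y_def intro!: finsum_closed)
  have YO: "Y e = f v e" if "v \<in> V" "e \<in> Out v" for v e
    using that own[OF that] by (auto simp: Y_def Outs_def)
  have YG: "Y e' = G f v e'" if v: "v \<in> V" "e' \<in> In v" for v e'
  proof -
    have NR: "(own u, v) \<in> NR" if uE: "(u, e') \<in> E" for u
    proof -
      obtain w where w: "w \<in> V" "u \<in> Out w" using edge[OF uE] by (auto simp: Outs_def)
      thus ?thesis using uE v own[OF w] by (auto simp: NR_def node_rel_def)
    qed
    have "e' \<notin> Outs" using v Outs_Ins by (auto simp: Ins_def)
    hence "Y e' = (\<Oplus>u\<in>{u. (u, e') \<in> E}. f (own u) u)" by (simp add: Y_def)
    also have "\<dots> = G f v e'"
      unfolding G_def by (rule finsum_cong') (use NR f_closed in auto)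
    finally show ?thesis .
  qed
  show ?thesis
  proof (rule exI[of _ Y], unfold coding_equations_def, intro conjI ballI)
    show "Y e \<in> carrier R" for e by (rule Yc)
    fix v e assume v: "v \<in> V"
    show "Y e = (\<Oplus>e'\<in>In v. \<beta> e' e \<otimes> Y e') \<oplus> (if v = S then \<Oplus>i\<in>{1..mu}. \<alpha> i e \<otimes> x i else \<zero>)"
      if e: "e \<in> Out v"
    proof -
      have "(\<Oplus>e'\<in>In v. \<beta> e' e \<otimes> G f v e') = (\<Oplus>e'\<in>In v. \<beta> e' e \<otimes> Y e')"
        by (rule finsum_cong') (use YG[OF v, symmetric] Yc \<beta> in auto)
      thus ?thesis using YO[OF v e] fun_cong[OF fH[of v], of e] by (simp add: H_def)
    qed
    show "Y e = finsum R Y {u. (u, e) \<in> E}" if e: "e \<in> In v"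
    proof -
      have "e \<notin> Outs" using v e Outs_Ins by (auto simp: Ins_def)
      hence "Y e = (\<Oplus>u\<in>{u. (u, e) \<in> E}. f (own u) u)" by (simp add: Y_def)
      also have "\<dots> = finsum R Y {u. (u, e) \<in> E}"
        by (rule finsum_cong') (use edge Yc f_closed in \<open>auto simp: Y_def\<close>)
      finally show ?thesis .
    qed
  qed
qed

text \<open>Induction along the network on the sink side: an input receives a part across the cut,
  equal by assumption, and a part from earlier nodes of the sink side, equal by induction. The
  messages may differ because the source lies in \<open>\<Omega>\<close>.\<close>

lemma coding_determined_by_cut:
  assumes Y: "coding_equations R V In Out E S mu \<alpha> \<beta> x Y"
    and Y': "coding_equations R V In Out E S mu \<alpha> \<beta> x' Y'"
    and \<beta>: "\<And>e' e. \<beta> e' e \<in> carrier R" and \<Omega>: "\<Omega> \<subseteq> V" "S \<in> \<Omega>"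
    and h: "\<And>w j. w \<in> V - \<Omega> \<Longrightarrow> j \<in> In w \<Longrightarrow>
      lincomb (\<Union>v\<in>\<Omega>. Out v) Y (cut_matrix R E) j = lincomb (\<Union>v\<in>\<Omega>. Out v) Y' (cut_matrix R E) j"
    and w: "w \<in> V - \<Omega>" "e \<in> In w"
  shows "Y e = Y' e"
proof -
  let ?O = "\<Union>v\<in>\<Omega>. Out v"
  have finO: "finite ?O" using \<Omega>(1) fin_ports finite_subset by (meson finite_UN_I subsetD)
  have cl: "Z e \<in> carrier R" if "coding_equations R V In Out E S mu \<alpha> \<beta> z Z" "e \<in> Outs \<union> Ins" for z Z e
    using that by (simp add: coding_equations_def ports_eq)
  have O_sub: "?O \<subseteq> Outs" using \<Omega>(1) by (auto simp: Outs_def)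
  have split: "Z j = lincomb ?O Z (cut_matrix R E) j \<oplus> (\<Oplus>u\<in>{u. (u, j) \<in> E} - ?O. Z u)"
    if Z: "coding_equations R V In Out E S mu \<alpha> \<beta> z Z" and j: "v \<in> V" "j \<in> In v" for z Z v j
  proof -
    let ?Q = "{u. (u, j) \<in> E}"
    have Q: "?Q \<subseteq> Outs" using edge by auto
    have ZO: "Z e \<in> carrier R" if "e \<in> Outs" for e using cl[OF Z] that by simp
    have "Z j = finsum R Z ?Q" using Z j by (simp add: coding_equations_def)
    also have "?Q = (?Q \<inter> ?O) \<union> (?Q - ?O)" by blast
    also have "finsum R Z \<dots> = finsum R Z (?Q \<inter> ?O) \<oplus> finsum R Z (?Q - ?O)"
      by (rule finsum_Un_disjoint) (use fin_preds ZO Q in auto)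
    also have "finsum R Z (?Q \<inter> ?O) = lincomb ?O Z (cut_matrix R E) j"
      unfolding lincomb_def
      by (rule add.finprod_mono_neutral_cong_left)
        (use finO ZO O_sub in \<open>auto simp: cut_matrix_def\<close>)
    finally show ?thesis .
  qed
  have "\<forall>e\<in>In w \<union> Out w. Y e = Y' e"
    using w(1)
  proof (induction w rule: wf_induct_rule[OF wf_node_rel])
    case (1 w)
    have I: "Y j = Y' j" if j: "j \<in> In w" for j
    proof -
      have "(\<Oplus>u\<in>{u. (u, j) \<in> E} - ?O. Y u) = (\<Oplus>u\<in>{u. (u, j) \<in> E} - ?O. Y' u)"
      proof (rule finsum_cong')
        fix u assume u: "u \<in> {u. (u, j) \<in> E} - ?O"
        hence "u \<in> Outs" using edge by blast
        then obtain v where v: "v \<in> V" "u \<in> Out v" by (auto simp: Outs_def)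
        hence "v \<in> V - \<Omega>" "(v, w) \<in> node_rel V In Out E" using u j 1 by (auto simp: node_rel_def)
        thus "Y u = Y' u" using 1 v by blast
      qed (use cl[OF Y'] edge in auto)
      thus ?thesis using split[OF Y _ j] split[OF Y' _ j] h[OF 1(2) j] 1(2) by simp
    qed
    have "Y e = Y' e" if e: "e \<in> Out w" for e
    proof -
      have wS: "w \<noteq> S" and wV: "w \<in> V" using 1(2) \<Omega> by auto
      have YI: "Y' j \<in> carrier R" if "j \<in> In w" for j using cl[OF Y'] wV that by (auto simp: Ins_def)
      have "(\<Oplus>e'\<in>In w. \<beta> e' e \<otimes> Y e') = (\<Oplus>e'\<in>In w. \<beta> e' e \<otimes> Y' e')"
        by (rule finsum_cong') (use I YI \<beta> in auto)
      thus ?thesis using Y Y' wS wV e by (simp add: coding_equations_def)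
    qed
    thus ?case using I by blast
  qed
  thus ?thesis using w(2) by blast
qed

text \<open>Each message is mapped to the coefficients, over a row basis \<open>A\<close> of the cut
  matrix, of what crosses the cut. The sink recovers the message from these, so the map is injective
  and \<open>q ^ mu \<le> q ^ card A\<close>.\<close>

lemma solvable_imp_cut:
  assumes sol: "linearly_solvable R V In Out E S mu T N" and n: "n \<in> {1..N}"
    and Tn: "T n \<in> V" and \<Omega>: "\<Omega> \<subseteq> V" "S \<in> \<Omega>" "T n \<notin> \<Omega>"
  shows "\<exists>A \<subseteq> \<Union>v\<in>\<Omega>. Out v. mu \<le> card A \<and> lin_indep_rows R (\<Union>w\<in>V - \<Omega>. In w) (cut_matrix R E) A"
proof -
  let ?O = "\<Union>v\<in>\<Omega>. Out v" and ?W = "\<Union>w\<in>V - \<Omega>. In w" and ?M = "cut_matrix R E"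
  obtain \<alpha> \<beta> \<epsilon> where c: "\<And>i e. \<alpha> i e \<in> carrier R" "\<And>e' e. \<beta> e' e \<in> carrier R"
    "\<And>t e' k. \<epsilon> t e' k \<in> carrier R" and
    dec: "\<And>x Y k. x \<in> {1..mu} \<rightarrow> carrier R \<Longrightarrow> coding_equations R V In Out E S mu \<alpha> \<beta> x Y \<Longrightarrow> k \<in> {1..mu} \<Longrightarrow>
      (\<Oplus>e'\<in>In (T n). \<epsilon> (T n) e' k \<otimes> Y e') = x k"
    proof -
    obtain \<alpha> \<beta> \<epsilon> where *: "\<forall>i e. \<alpha> i e \<in> carrier R" "\<forall>e' e. \<beta> e' e \<in> carrier R"
      "\<forall>t e' k. \<epsilon> t e' k \<in> carrier R" and
      d: "\<forall>x\<in>{1..mu} \<rightarrow> carrier R. \<forall>Y. coding_equations R V In Out E S mu \<alpha> \<beta> x Y \<longrightarrow>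
        (\<forall>n\<in>{1..N}. \<forall>k\<in>{1..mu}. (\<Oplus>e'\<in>In (T n). \<epsilon> (T n) e' k \<otimes> Y e') = x k)"
      using sol unfolding linearly_solvable_def by (elim exE conjE) (rule that)
    show thesis
      by (rule that[of \<alpha> \<beta> \<epsilon>]) (use * d n in blast)+
  qed
  have finO: "finite ?O" using \<Omega>(1) fin_ports finite_subset by (meson finite_UN_I subsetD)
  have M: "is_mat ?M" by (simp add: is_mat_def cut_matrix_def)
  obtain A where A: "A \<subseteq> ?O" "lin_indep_rows R ?W ?M A" and
    span: "\<And>y. (\<And>i. y i \<in> carrier R) \<Longrightarrow> \<exists>b\<in>vecs A. \<forall>j\<in>?W. lincomb ?O y ?M j = lincomb A b ?M j"
    using spanning_lin_indep_rows[OF finO M, of ?W] by blast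
  have finA: "finite A" using A(1) finO finite_subset by blast
  let ?X = "PiE {1..mu} (\<lambda>_. carrier R)"
  have "\<forall>x\<in>?X. \<exists>Y. coding_equations R V In Out E S mu \<alpha> \<beta> x Y"
    using coding_solution_exists c by (auto simp: PiE_def)
  then obtain Y where Y: "\<And>x. x \<in> ?X \<Longrightarrow> coding_equations R V In Out E S mu \<alpha> \<beta> x (Y x)"
    by metis
  have YO: "Y x e \<in> carrier R" if "x \<in> ?X" "e \<in> ?O" for x e
  proof -
    have "e \<in> ports V In Out" using that(2) \<Omega>(1) by (auto simp: ports_def)
    thus ?thesis using Y[OF that(1)] by (simp add: coding_equations_def)
  qed
  have "\<exists>b\<in>vecs A. \<forall>j\<in>?W. lincomb ?O (Y x) ?M j = lincomb A b ?M j" if x: "x \<in> ?X" for x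
  proof -
    \<comment> \<open>\<open>span\<close> asks for field elements everywhere, while the coding
      equations control \<open>Y x\<close> only on ports.\<close>
    define y where "y e = (if e \<in> ?O then Y x e else \<zero>)" for e
    have "lincomb ?O (Y x) ?M j = lincomb ?O y ?M j" for j
      by (rule lincomb_cong) (use YO[OF x] M in \<open>auto simp: y_def\<close>)
    moreover have "y e \<in> carrier R" for e using YO[OF x] by (auto simp: y_def)
    ultimately show ?thesis using span[of y] by simp
  qed
  then obtain b where b: "\<And>x. x \<in> ?X \<Longrightarrow> b x \<in> vecs A"
    "\<And>x j. x \<in> ?X \<Longrightarrow> j \<in> ?W \<Longrightarrow> lincomb ?O (Y x) ?M j = lincomb A (b x) ?M j"
    by metis
  have "inj_on b ?X"
  proof (rule inj_onI)
    fix x x' assume x: "x \<in> ?X" and x': "x' \<in> ?X" and e: "b x = b x'"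
    have "Y x e = Y x' e" if "e \<in> In (T n)" for e
    proof (rule coding_determined_by_cut[OF Y[OF x] Y[OF x'] c(2) \<Omega>(1,2)])
      show "lincomb ?O (Y x) ?M j = lincomb ?O (Y x') ?M j" if "w \<in> V - \<Omega>" "j \<in> In w" for w j
      proof -
        have "j \<in> ?W" using that by blast
        thus ?thesis using b(2)[OF x] b(2)[OF x'] e by simp
      qed
    qed (use that Tn \<Omega> in auto)
    moreover have "Y x' e \<in> carrier R" if "e \<in> In (T n)" for e
    proof -
      have "e \<in> ports V In Out" using that Tn by (auto simp: ports_def)
      thus ?thesis using Y[OF x'] by (simp add: coding_equations_def)
    qed
    ultimately have "(\<Oplus>e'\<in>In (T n). \<epsilon> (T n) e' k \<otimes> Y x e') = (\<Oplus>e'\<in>In (T n). \<epsilon> (T n) e' k \<otimes> Y x' e')" for k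
      by (intro finsum_cong') (use c(3) in auto)
    hence "x k = x' k" if "k \<in> {1..mu}" for k
      using dec[OF _ Y[OF x] that] dec[OF _ Y[OF x'] that] x x' by (auto simp: PiE_def)
    thus "x = x'" using x x' by (rule PiE_ext[rotated 2])
  qed
  hence "card ?X \<le> card (vecs A)"
    by (rule card_inj_on_le) (use b(1) finite_vecs[OF finA] in auto)
  also have "\<dots> \<le> q ^ card A" by (rule card_vecs_le[OF finA])
  finally have "q ^ mu \<le> q ^ card A" by (simp add: card_PiE q_def)
  hence "mu \<le> card A" using q_gt_1 by simp
  thus ?thesis using A by blast
qed

end

section \<open>Finite fields of prescribed characteristic\<close>

context field
begin

text \<open>The root is the class of the variable modulo an irreducible factor \<open>m\<close> of
  \<open>f\<close>. The quotient is finite because its classes are represented by remainders of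
  bounded degree.\<close>

lemma root_in_finite_extension:
  assumes fin: "finite (carrier R)" and f: "f \<in> carrier (poly_ring R)" and deg: "degree f > 0"
  obtains K :: "'a list set ring" and h x where "field K" "finite (carrier K)" "h \<in> ring_hom R K"
    "x \<in> carrier K" "ring.eval K (map h f) x = \<zero>\<^bsub>K\<^esub>"
proof -
  let ?C = "carrier R"
  interpret UP: principal_domain "poly_ring R"
    using univ_poly_is_principal[OF carrier_is_subfield] .
  have "f \<notin> Units (poly_ring R)" "f \<in> carrier (poly_ring R) - {\<zero>\<^bsub>poly_ring R\<^esub>}"
    using univ_poly_units'[OF carrier_is_subfield, of f] f deg by (auto simp: univ_poly_zero)
  then obtain m where m: "m \<in> carrier (poly_ring R)" "pirreducible ?C m" "m divides\<^bsub>poly_ring R\<^esub> f"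
    using UP.exists_irreducible_divisor by blast
  let ?K = "Rupt ?C m" and ?s = "rupture_surj ?C m"
  interpret K: field ?K
    using rupture_is_field_iff_pirreducible[OF carrier_is_subfield m(1)] m(2) by simp
  interpret Hom: ring_hom_ring "poly_ring R" ?K ?s
    using rupture_surj_hom(2)[OF carrier_is_subring m(1)] .
  have "m \<noteq> []" using m(2) pirreducibleE(1)[OF carrier_is_subring m(1)] by simp
  have "{l \<in> carrier (poly_ring R). length l \<le> degree m} \<subseteq> {l. set l \<subseteq> ?C \<and> length l \<le> degree m}"
    unfolding sym[OF univ_poly_carrier] polynomial_def by auto
  hence "finite ((\<lambda>l. l pmod m) ` carrier (poly_ring R))"
    unfolding pmod_image_characterization[OF carrier_is_subfield m(1) \<open>m \<noteq> []\<close>]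
    using finite_lists_length_le[OF fin, of "degree m"] finite_subset by blast
  hence 1: "finite (carrier ?K)"
    unfolding sym[OF rupture_carrier_as_pmod_image[OF carrier_is_subfield m(1)]] by simp
  have 2: "?s \<circ> poly_of_const \<in> ring_hom R ?K"
    using rupture_surj_norm_is_hom[OF carrier_is_subring m(1)] by simp
  have 3: "?s X \<in> carrier ?K" using var_closed(1)[OF carrier_is_subring] by (rule Hom.hom_closed)
  have "K.eval (map (?s \<circ> poly_of_const) f) (?s X) = ?s (UP.eval (map poly_of_const f) X)"
    using Hom.eval_hom[OF UP.carrier_is_subring var_closed(1)[OF carrier_is_subring]
        map_norm_in_poly_ring_carrier[OF carrier_is_subring f]] by simp
  also have "\<dots> = ?s f" unfolding sym[OF eval_rewrite[OF carrier_is_subring f]] ..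
  also have "\<dots> = \<zero>\<^bsub>?K\<^esub>"
  proof -
    obtain g where g: "g \<in> carrier (poly_ring R)" "f = m \<otimes>\<^bsub>poly_ring R\<^esub> g"
      using m(3) by (auto simp: factor_def)
    hence "f \<in> PIdl\<^bsub>poly_ring R\<^esub> m"
      using UP.m_comm[OF m(1) g(1)] by (auto simp: cgenideal_def)
    thus ?thesis
      using UP.a_rcos_zero[OF UP.cgenideal_ideal[OF m(1)]] unfolding rupture_def FactRing_def by simp
  qed
  finally show thesis using that[OF K.field_axioms 1 2 3] by blast
qed

lemma add_pow_one_eq_zero_iff:
  assumes p: "Factorial_Ring.prime p" and p0: "[p] \<cdot> \<one> = \<zero>"
  shows "[n] \<cdot> \<one> = \<zero> \<longleftrightarrow> p dvd (n::nat)"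
proof
  assume "p dvd n"
  then obtain k where "n = p * k" by blast
  hence "[n] \<cdot> \<one> = [k] \<cdot> ([p] \<cdot> \<one>)" by (simp add: add.nat_pow_pow)
  thus "[n] \<cdot> \<one> = \<zero>" by (simp add: p0)
next
  assume n0: "[n] \<cdot> \<one> = \<zero>"
  show "p dvd n"
  proof (rule ccontr)
    assume "\<not> p dvd n"
    hence "coprime p n" using p prime_imp_coprime by blast
    moreover have "p \<noteq> 0" using p by auto
    ultimately obtain x y where "p * x = n * y + 1" using bezout_nat[of p n] by (auto simp: coprime_iff_gcd_eq_1)
    hence "[(p * x)] \<cdot> \<one> = [(n * y + 1)] \<cdot> \<one>" by simp
    moreover have "[(p * x)] \<cdot> \<one> = [x] \<cdot> ([p] \<cdot> \<one>)" "[(n * y)] \<cdot> \<one> = [y] \<cdot> ([n] \<cdot> \<one>)"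
      by (simp_all add: add.nat_pow_pow)
    moreover have "[(n * y + 1)] \<cdot> \<one> = [(n * y)] \<cdot> \<one> \<oplus> [(1::nat)] \<cdot> \<one>"
      by (rule add.nat_pow_mult[symmetric]) simp
    ultimately show False by (simp add: n0 p0)
  qed
qed

lemma ring_char_eqI:
  assumes "Factorial_Ring.prime p" "[p] \<cdot> \<one> = \<zero>"
  shows "ring_char R = p"
  unfolding ring_char_def
proof (rule Least_equality)
  show "0 < p \<and> [p] \<cdot> \<one> = \<zero>" using assms prime_gt_0_nat by blast
  show "p \<le> n" if "0 < n \<and> [n] \<cdot> \<one> = \<zero>" for n
    using that add_pow_one_eq_zero_iff[OF assms] dvd_imp_le by blast
qed

text \<open>\<open>LEAST\<close> yields this only if some positive multiple of one vanishes; the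
  order of the finite additive group provides one.\<close>

lemma ring_charD:
  assumes "finite (carrier R)" "ring_char R = p"
  shows "[p] \<cdot> \<one> = \<zero>"
proof -
  have "[(order (add_monoid R))] \<cdot> \<one> = \<zero>"
    using add.pow_order_eq_1[of \<one>] by simp
  moreover have "order (add_monoid R) > 0"
    using assms(1) by (auto simp: order_def card_gt_0_iff)
  ultimately show ?thesis
    using assms(2) unfolding ring_char_def
    by (metis (mono_tags, lifting) LeastI)
qed

text \<open>The list is the polynomial \<open>1 + x + ... + x^(n-1)\<close>, and the product
  telescopes.\<close>

lemma eval_replicate_one:
  assumes "x \<in> carrier R"
  shows "(x \<ominus> \<one>) \<otimes> eval (replicate n \<one>) x = x [^] n \<ominus> \<one>"
proof (induction n)
  case (Suc n)
  have e: "eval (replicate n \<one>) x \<in> carrier R" by (rule eval_in_carrier) (use assms in auto)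
  have xn: "x [^] n \<in> carrier R" using assms by simp
  have "(x \<ominus> \<one>) \<otimes> eval (replicate (Suc n) \<one>) x = (x \<ominus> \<one>) \<otimes> (x [^] n \<oplus> eval (replicate n \<one>) x)"
    using xn by simp
  also have "\<dots> = (x \<ominus> \<one>) \<otimes> x [^] n \<oplus> (x \<ominus> \<one>) \<otimes> eval (replicate n \<one>) x"
    using e xn assms by (simp add: r_distr)
  also have "\<dots> = (x \<ominus> \<one>) \<otimes> x [^] n \<oplus> (x [^] n \<ominus> \<one>)" by (simp add: Suc)
  also have "\<dots> = x [^] n \<otimes> x \<ominus> \<one>" using xn assms by algebra
  finally show ?case by simp
qed (use assms in \<open>simp add: a_minus_def r_neg\<close>)

lemma eval_replicate_one_one: "eval (replicate n \<one>) \<one> = [n] \<cdot> \<one>"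
proof (induction n)
  case (Suc n)
  thus ?case by (simp add: add.m_comm)
qed simp

end

lemma ring_hom_add_pow_one:
  assumes "ring A" "ring B" "h \<in> ring_hom A B"
  shows "h (add_pow A (n::nat) \<one>\<^bsub>A\<^esub>) = add_pow B n \<one>\<^bsub>B\<^esub>"
proof -
  interpret ring_hom_ring A B h
    using assms ring_hom_ringI2 by blast
  show ?thesis by (induction n) simp_all
qed

text \<open>A root of \<open>1 + x + \<dots> + x\<^sup>r\<^sup>-\<^sup>1\<close> for a prime \<open>r \<noteq> p\<close> has multiplicative order \<open>r\<close>, which
  makes the field generated by it large.\<close>

lemma exists_large_finite_field:
  assumes p: "Factorial_Ring.prime p"
  obtains R :: "nat ring" where "field R" "finite (carrier R)" "ring_char R = p" "N < card (carrier R)"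
proof -
  \<comment> \<open>\<open>r > N\<close> makes the field large enough; \<open>r > p\<close> makes
    \<open>r\<close> different from \<open>p\<close>, so that one is not a root of the
    polynomial.\<close>
  obtain r where r: "Factorial_Ring.prime r" "r > max N p" using bigger_prime by blast
  define F where "F = residue_ring (int p)"
  interpret F: residues_prime p F using p by unfold_locales (simp_all add: F_def)
  let ?f = "replicate r \<one>\<^bsub>F\<^esub>"
  have r2: "r \<ge> 2" using r prime_ge_2_nat by blast
  have f: "?f \<in> carrier (poly_ring F)"
    unfolding sym[OF univ_poly_carrier] polynomial_def using r2 by auto
  have p0: "add_pow F p \<one>\<^bsub>F\<^esub> = \<zero>\<^bsub>F\<^esub>"
  proof -
    have "order (add_monoid F) = p" by (simp add: order_def F.res_carrier_eq)
    thus ?thesis using F.add.pow_order_eq_1[of "\<one>\<^bsub>F\<^esub>"] by simp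
  qed
  obtain K :: "int list set ring" and h x where K: "field K" "finite (carrier K)" "h \<in> ring_hom F K"
      "x \<in> carrier K" "ring.eval K (map h ?f) x = \<zero>\<^bsub>K\<^esub>"
    by (rule F.root_in_finite_extension[OF F.finite f]) (use r2 in auto)
  interpret K: field K by fact
  have p0K: "add_pow K p \<one>\<^bsub>K\<^esub> = \<zero>\<^bsub>K\<^esub>"
    using ring_hom_add_pow_one[OF F.ring_axioms K.ring_axioms K(3), of p] p0
      ring_hom_zero[OF K(3) F.ring_axioms K.ring_axioms] by simp
  have ev: "K.eval (replicate r \<one>\<^bsub>K\<^esub>) x = \<zero>\<^bsub>K\<^esub>"
    using K(5) ring_hom_one[OF K(3)] by (simp add: map_replicate_const[symmetric] map_replicate)
  have "x \<noteq> \<one>\<^bsub>K\<^esub>"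
  proof
    assume "x = \<one>\<^bsub>K\<^esub>"
    hence dvd: "p dvd r" using ev K.add_pow_one_eq_zero_iff[OF p p0K, of r] K.eval_replicate_one_one by simp
    have "p = r" by (rule primes_dvd_imp_eq[OF p r(1) dvd])
    thus False using r(2) by simp
  qed
  have "x [^]\<^bsub>K\<^esub> r \<ominus>\<^bsub>K\<^esub> \<one>\<^bsub>K\<^esub> = \<zero>\<^bsub>K\<^esub>"
    using K.eval_replicate_one[OF K(4), of r] ev K(4) by simp
  hence xr: "x [^]\<^bsub>K\<^esub> r = \<one>\<^bsub>K\<^esub>" using K(4) by simp
  have "x \<noteq> \<zero>\<^bsub>K\<^esub>" using xr r2 K(4) by (auto simp: K.nat_pow_zero)
  interpret G: group "Multiplicative_Group.mult_of K" by (rule K.field_mult_group)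
  have xG: "x \<in> carrier (Multiplicative_Group.mult_of K)" using K(4) \<open>x \<noteq> \<zero>\<^bsub>K\<^esub>\<close> by simp
  have "x [^]\<^bsub>Multiplicative_Group.mult_of K\<^esub> r = \<one>\<^bsub>Multiplicative_Group.mult_of K\<^esub>" using xr by (simp add: Multiplicative_Group.nat_pow_mult_of)
  hence "G.ord x dvd r" using G.pow_eq_id[OF xG] by simp
  moreover have "G.ord x \<noteq> 1" using G.ord_eq_1[OF xG] \<open>x \<noteq> \<one>\<^bsub>K\<^esub>\<close> by simp
  ultimately have "G.ord x = r" using r(1) prime_nat_iff by blast
  moreover have "G.ord x \<le> order (Multiplicative_Group.mult_of K)"
    by (rule G.ord_le_group_order) (use K(2) xG in auto)
  ultimately have "r \<le> card (carrier K)"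
    using K(2) by (simp add: order_def)
  hence NK: "N < card (carrier K)" using r(2) by simp
  \<comment> \<open>The extension has elements of type \<open>int list set\<close>, while the
    theorem asks for a \<open>nat ring\<close>; finiteness allows the structure to be transported
    along an injection.\<close>
  obtain g :: "int list set \<Rightarrow> nat" where g: "inj_on g (carrier K)"
    using finite_imp_inj_to_nat_seg[OF K(2)] by blast
  define L where "L = image_ring g K"
  interpret L: field L unfolding L_def by (rule K.inj_imp_image_ring_is_field[OF g])
  have hom: "g \<in> ring_hom K L"
    using inj_imp_image_ring_iso[OF g] by (simp add: L_def ring_iso_def)
  have "add_pow L p \<one>\<^bsub>L\<^esub> = \<zero>\<^bsub>L\<^esub>"
    using ring_hom_add_pow_one[OF K.ring_axioms L.ring_axioms hom, of p] p0K
      ring_hom_zero[OF hom K.ring_axioms L.ring_axioms] by simp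
  hence "ring_char L = p" by (rule L.ring_char_eqI[OF p])
  moreover have "carrier L = g ` carrier K" by (simp add: L_def image_ring_carrier)
  ultimately show thesis
    using that[OF L.field_axioms] NK K(2) card_image[OF g] by simp
qed

section \<open>The min-cut criterion\<close>

lemma le_mat_rank_iff:
  assumes "finite I"
  shows "m \<le> mat_rank K I J M \<longleftrightarrow> (\<exists>A \<subseteq> I. m \<le> card A \<and> lin_indep_rows K J M A)"
proof -
  let ?C = "{card A | A. A \<subseteq> I \<and> lin_indep_rows K J M A}"
  have "finite ?C"
    by (rule finite_subset[of _ "card ` Pow I"]) (use assms in auto)
  moreover have "lin_indep_rows K J M {}" by (simp add: lin_indep_rows_def)
  hence "?C \<noteq> {}" by blast
  ultimately have "m \<le> mat_rank K I J M \<longleftrightarrow> (\<exists>x\<in>?C. m \<le> x)"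
    unfolding mat_rank_def by (rule Max_ge_iff)
  thus ?thesis by blast
qed

lemma le_mincut_iff:
  assumes net: "adt_network V In Out E" and "S \<in> V" "t \<noteq> S"
  shows "m \<le> mincut K V In Out E S t \<longleftrightarrow> (\<forall>\<Omega>. \<Omega> \<subseteq> V \<longrightarrow> S \<in> \<Omega> \<longrightarrow> t \<notin> \<Omega> \<longrightarrow>
    (\<exists>A \<subseteq> \<Union>v\<in>\<Omega>. Out v. m \<le> card A \<and> lin_indep_rows K (\<Union>w\<in>V - \<Omega>. In w) (cut_matrix K E) A))"
proof -
  let ?f = "\<lambda>\<Omega>. mat_rank K (\<Union>v\<in>\<Omega>. Out v) (\<Union>w\<in>V - \<Omega>. In w) (cut_matrix K E)"
  let ?C = "{?f \<Omega> | \<Omega>. \<Omega> \<subseteq> V \<and> S \<in> \<Omega> \<and> t \<notin> \<Omega>}"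
  have finV: "finite V" and finO: "\<And>v. v \<in> V \<Longrightarrow> finite (Out v)"
    using net by (auto simp: adt_network_def)
  have "finite ?C" by (rule finite_subset[of _ "?f ` Pow V"]) (use finV in auto)
  moreover have "?f {S} \<in> ?C" using assms by blast
  hence "?C \<noteq> {}" by blast
  ultimately have "m \<le> mincut K V In Out E S t \<longleftrightarrow> (\<forall>x\<in>?C. m \<le> x)"
    unfolding mincut_def by (rule Min_ge_iff)
  also have "\<dots> \<longleftrightarrow> (\<forall>\<Omega>. \<Omega> \<subseteq> V \<longrightarrow> S \<in> \<Omega> \<longrightarrow> t \<notin> \<Omega> \<longrightarrow> m \<le> ?f \<Omega>)" by blast
  also have "\<dots> \<longleftrightarrow> (\<forall>\<Omega>. \<Omega> \<subseteq> V \<longrightarrow> S \<in> \<Omega> \<longrightarrow> t \<notin> \<Omega> \<longrightarrow>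
    (\<exists>A \<subseteq> \<Union>v\<in>\<Omega>. Out v. m \<le> card A \<and> lin_indep_rows K (\<Union>w\<in>V - \<Omega>. In w) (cut_matrix K E) A))"
  proof -
    have "m \<le> ?f \<Omega> \<longleftrightarrow> (\<exists>A \<subseteq> \<Union>v\<in>\<Omega>. Out v. m \<le> card A \<and>
        lin_indep_rows K (\<Union>w\<in>V - \<Omega>. In w) (cut_matrix K E) A)" if "\<Omega> \<subseteq> V" for \<Omega>
      by (rule le_mat_rank_iff) (use that finV finO finite_subset in blast)
    thus ?thesis by blast
  qed
  finally show ?thesis .
qed

text \<open>Operations of \<open>residue_ring\<close> are integer operations followed by reduction
  modulo \<open>p\<close>. Since \<open>p\<close> annihilates one, reduction does not change the
  multiple of one, and the laws of integer multiples remain.\<close>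

lemma residue_ring_hom:
  assumes p: "Factorial_Ring.prime p" and R: "field R" and p0: "add_pow R p \<one>\<^bsub>R\<^esub> = \<zero>\<^bsub>R\<^esub>"
  shows "(\<lambda>n. add_pow R n \<one>\<^bsub>R\<^esub>) \<in> ring_hom (residue_ring (int p)) R"
proof -
  interpret R: field R by fact
  have md: "add_pow R (n mod int p) \<one>\<^bsub>R\<^esub> = add_pow R n \<one>\<^bsub>R\<^esub>" for n :: int
  proof -
    have "add_pow R (int p * (n div int p)) \<one>\<^bsub>R\<^esub> = add_pow R (n div int p) (add_pow R (int p) \<one>\<^bsub>R\<^esub>)"
      by (rule R.add.int_pow_pow[symmetric, unfolded mult.commute[of _ "int p"]]) simp
    also have "add_pow R (int p) \<one>\<^bsub>R\<^esub> = \<zero>\<^bsub>R\<^esub>" using p0 by (simp add: add_pow_int_ge)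
    finally have z: "add_pow R (int p * (n div int p)) \<one>\<^bsub>R\<^esub> = \<zero>\<^bsub>R\<^esub>" by simp
    have "add_pow R (int p * (n div int p) + n mod int p) \<one>\<^bsub>R\<^esub>
        = add_pow R (int p * (n div int p)) \<one>\<^bsub>R\<^esub> \<oplus>\<^bsub>R\<^esub> add_pow R (n mod int p) \<one>\<^bsub>R\<^esub>"
      by (rule R.add.int_pow_mult) simp
    thus ?thesis by (simp add: z)
  qed
  show ?thesis
  proof (rule ring_hom_memI)
    fix m n :: int
    show "add_pow R (m \<otimes>\<^bsub>residue_ring (int p)\<^esub> n) \<one>\<^bsub>R\<^esub> = add_pow R m \<one>\<^bsub>R\<^esub> \<otimes>\<^bsub>R\<^esub> add_pow R n \<one>\<^bsub>R\<^esub>"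
      by (simp add: residue_ring_def md R.add_pow_ldistr_int R.add.int_pow_pow mult.commute)
    show "add_pow R (m \<oplus>\<^bsub>residue_ring (int p)\<^esub> n) \<one>\<^bsub>R\<^esub> = add_pow R m \<one>\<^bsub>R\<^esub> \<oplus>\<^bsub>R\<^esub> add_pow R n \<one>\<^bsub>R\<^esub>"
      by (simp add: residue_ring_def md R.add.int_pow_mult)
    show "add_pow R \<one>\<^bsub>residue_ring (int p)\<^esub> \<one>\<^bsub>R\<^esub> = \<one>\<^bsub>R\<^esub>"
      by (simp add: residue_ring_def)
  qed simp
qed

lemma lin_indep_cut_matrix_iff:
  assumes p: "Factorial_Ring.prime p" and R: "field R" "finite (carrier R)" "ring_char R = p"
    and fin: "finite A" "finite J"
  shows "lin_indep_rows R J (cut_matrix R E) A \<longleftrightarrow>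
    lin_indep_rows (residue_ring (int p)) J (cut_matrix (residue_ring (int p)) E) A"
proof -
  let ?F = "residue_ring (int p)" and ?h = "\<lambda>n::int. add_pow R n \<one>\<^bsub>R\<^esub>"
  interpret F: residues_prime p ?F using p by unfold_locales simp_all
  interpret R: field R by fact
  have h: "?h \<in> ring_hom ?F R"
    by (rule residue_ring_hom[OF p R(1) R.ring_charD[OF R(2,3)]])
  have "(\<lambda>r j. ?h (cut_matrix ?F E r j)) = cut_matrix R E"
    by (simp add: cut_matrix_def fun_eq_iff F.res_zero_eq F.res_one_eq add_pow_int_ge)
  thus ?thesis
    using lin_indep_rows_hom_iff[OF F.field_axioms R(1) h fin, of "cut_matrix ?F E"]
    by (simp add: cut_matrix_def)
qed

theorem theorem4:
  fixes V :: "'v set" and In Out :: "'v \<Rightarrow> 'p set" and E :: "('p \<times> 'p) set"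
    and S :: 'v and T :: "nat \<Rightarrow> 'v" and N mu p :: nat
  assumes "adt_network V In Out E"
    and "S \<in> V"
    and "\<forall>n \<in> {1..N}. T n \<in> V \<and> T n \<noteq> S"
    and "Factorial_Ring.prime p"
  shows "(\<exists>R :: nat ring. field R \<and> finite (carrier R) \<and> ring_char R = p \<and>
            linearly_solvable R V In Out E S mu T N)
         \<longleftrightarrow> (\<forall>n \<in> {1..N}. mu \<le> mincut (residue_ring (int p)) V In Out E S (T n))"
proof -
  have finIn: "finite (\<Union>w\<in>V - \<Omega>. In w)" for \<Omega>
    using assms(1) by (auto simp: adt_network_def)
  have finA: "finite A" if "\<Omega> \<subseteq> V" "A \<subseteq> (\<Union>v\<in>\<Omega>. Out v)" for \<Omega> A
  proof (rule finite_subset)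
    show "A \<subseteq> (\<Union>v\<in>V. Out v)" using that by blast
    show "finite (\<Union>v\<in>V. Out v)" using assms(1) by (auto simp: adt_network_def)
  qed
  \<comment> \<open>The min-cut is measured over the prime field while coding takes place over
    \<open>R\<close>; the cut condition is therefore restated over \<open>R\<close>, cut by
    cut.\<close>
  have change: "mu \<le> mincut (residue_ring (int p)) V In Out E S (T n) \<longleftrightarrow>
      (\<forall>\<Omega>. \<Omega> \<subseteq> V \<longrightarrow> S \<in> \<Omega> \<longrightarrow> T n \<notin> \<Omega> \<longrightarrow>
        (\<exists>A \<subseteq> \<Union>v\<in>\<Omega>. Out v. mu \<le> card A \<and> lin_indep_rows R (\<Union>w\<in>V - \<Omega>. In w) (cut_matrix R E) A))"
    if R: "field R" "finite (carrier R)" "ring_char R = p" and n: "n \<in> {1..N}" for R :: "nat ring" and n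
  proof -
    have "T n \<noteq> S" using assms(3) n by blast
    show ?thesis
      unfolding le_mincut_iff[OF assms(1,2) \<open>T n \<noteq> S\<close>]
      using lin_indep_cut_matrix_iff[OF assms(4) R finA finIn] by (metis (no_types, lifting))
  qed
  have net: "coded_network R V In Out E S" if "field R" "finite (carrier R)" for R :: "nat ring"
    using that assms
    by (simp add: coded_network_def coded_network_axioms_def finite_field_def finite_field_axioms_def)
  show ?thesis
  proof (intro iffI ballI)
    fix n assume n: "n \<in> {1..N}"
    assume "\<exists>R :: nat ring. field R \<and> finite (carrier R) \<and> ring_char R = p \<and>
            linearly_solvable R V In Out E S mu T N"
    then obtain R :: "nat ring" where R: "field R" "finite (carrier R)" "ring_char R = p"
      and sol: "linearly_solvable R V In Out E S mu T N" by blast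
    show "mu \<le> mincut (residue_ring (int p)) V In Out E S (T n)"
      unfolding change[OF R n]
      using coded_network.solvable_imp_cut[OF net[OF R(1,2)] sol n] assms(3) n by blast
  next
    assume cut: "\<forall>n\<in>{1..N}. mu \<le> mincut (residue_ring (int p)) V In Out E S (T n)"
    obtain R :: "nat ring" where R: "field R" "finite (carrier R)" "ring_char R = p"
      and N: "N < card (carrier R)"
      using exists_large_finite_field[OF assms(4)] by blast
    interpret coded_network R V In Out E S by (rule net[OF R(1,2)])
    have "linearly_solvable R V In Out E S mu T N"
    proof (rule multicast_solvable)
      show "N < q" using N by (simp add: q_def)
      show "T n \<in> V \<and> T n \<noteq> S" if "n \<in> {1..N}" for n using assms(3) that by blast
      show "\<exists>A \<subseteq> \<Union>v\<in>\<Omega>. Out v. mu \<le> card A \<and> lin_indep_rows R (\<Union>w\<in>V - \<Omega>. In w) (cut_matrix R E) A"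
        if "n \<in> {1..N}" "\<Omega> \<subseteq> V" "S \<in> \<Omega>" "T n \<notin> \<Omega>" for n \<Omega>
        using cut change[OF R that(1)] that by blast
    qed
    thus "\<exists>R :: nat ring. field R \<and> finite (carrier R) \<and> ring_char R = p \<and>
            linearly_solvable R V In Out E S mu T N"
      using R by blast
  qed
qed

end
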